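(* Assume the Hitting Set Conjecture. Then there is no $\varepsilon>0$ such that for all $c\ge 1$ there is an algorithm that solves Balanced Vertex in ${\cal O}(n^{2-\varepsilon})$ time on the $n$-vertex graphs with at most $cn\log n$ edges.
   Context: Hitting Set Conjecture: there is no $\varepsilon>0$ such that for all $c\ge 1$ there is an algorithm that, given two lists $A,B$ of $n$ subsets of a universe $U$ of size at most $c\log n$, can decide in ${\cal O}(n^{2-\varepsilon})$ time if there is a set in the first list $A$ that intersects every set in the second list $B$ (a "hitting set"). All graphs are finite, simple, connected, with unit-length edges; $d(u,v)$ is the shortest-path distance. A proper vertex list is a list $S=(s_1,\ldots,s_p)$ of pairwise different vertices; $d(v,S)=\min_i d(v,s_i)$. The (prioritized) Voronoi diagram of $G=(V,E)$ with respect to $S$ is the partition of $V$ into territories $\mathbb{T}(s_1,S),\ldots,\mathbb{T}(s_p,S)$ where $v\in\mathbb{T}(s_i,S)$ if and only if $d(v,s_i)=d(v,S)$ and $d(v,s_j)>d(v,S)$ for every $j$ with $1\le j<i$. For a cost function $\pi:V\to\mathbb{R}_{\ge 0}$, the load of $s_i$ is $\ell_\pi(s_i,S)=\sum_{v\in\mathbb{T}(s_i,S)}\pi(v)$, and $L_\pi(S)=\max_i \ell_\pi(s_i,S)$. For $v\in V\setminus S$, $S+v=(s_1,\ldots,s_p,v)$. Balanced Vertex: given a graph $G=(V,E)$, a cost function $\pi:V\to\mathbb{R}_{\ge 0}$ and a proper vertex list $S$, output a vertex $v\in V\setminus S$ such that $L_\pi(S+v)$ is minimized. Running times are worst-case,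 in the usual unit-cost RAM model. *)

theory Defs
  imports Complex_Main "HOL-Library.Landau_Symbols"
begin

section \<open>The unit-cost RAM\<close>

text \<open>
  The costs in Balanced Vertex are arbitrary nonnegative reals, so the machine has two
  memories: one for natural numbers (words), which can also serve as addresses, and one for
  reals.  Every instruction costs one time unit.  There is no rounding of reals to words.
  Semantically words are unbounded; the usual restriction to words of
  logarithmically many bits is part of the notion of an algorithm (\<open>solvable_in\<close> below).
  Without it, unit-cost multiplication and division would make the machine unrealistically strong.
\<close>

datatype word_op = WAdd | WSub | WMul | WDiv | WMod | WAnd | WOr | WXor | WShl | WShr

datatype real_op = RAdd | RSub | RMul | RDiv

text \<open>Subtraction of words is truncated at 0; division by 0 gives 0.\<close>

fun eval_wop :: "word_op \<Rightarrow> nat \<Rightarrow> nat \<Rightarrow> nat" where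
  "eval_wop WAdd x y = x + y"
| "eval_wop WSub x y = x - y"
| "eval_wop WMul x y = x * y"
| "eval_wop WDiv x y = x div y"
| "eval_wop WMod x y = x mod y"
| "eval_wop WAnd x y = semiring_bit_operations_class.and x y"
| "eval_wop WOr x y = semiring_bit_operations_class.or x y"
| "eval_wop WXor x y = semiring_bit_operations_class.xor x y"
| "eval_wop WShl x y = push_bit y x"
| "eval_wop WShr x y = drop_bit y x"

fun eval_rop :: "real_op \<Rightarrow> real \<Rightarrow> real \<Rightarrow> real" where
  "eval_rop RAdd x y = x + y"
| "eval_rop RSub x y = x - y"
| "eval_rop RMul x y = x * y"
| "eval_rop RDiv x y = x / y"

text \<open>Explicit numbers are cell addresses, except for the value stored by \<open>Const\<close> and the
  jump targets.\<close>

datatype instr =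
    Const nat nat
  | WOp word_op nat nat nat
  | WLoad nat nat
  | WStore nat nat
  | ROfWord nat nat
  | ROp real_op nat nat nat
  | RLoad nat nat
  | RStore nat nat
  | Jump nat
  | WJumpLess nat nat nat
  | RJumpLess nat nat nat

type_synonym program = "instr list"

record state =
  pc :: nat
  wmem :: "nat \<Rightarrow> nat"
  rmem :: "nat \<Rightarrow> real"

fun exec :: "instr \<Rightarrow> state \<Rightarrow> state" where
  "exec (Const i c) s = s\<lparr>pc := Suc (pc s), wmem := (wmem s)(i := c)\<rparr>"
| "exec (WOp f i j k) s =
     s\<lparr>pc := Suc (pc s), wmem := (wmem s)(i := eval_wop f (wmem s j) (wmem s k))\<rparr>"
| "exec (WLoad i j) s = s\<lparr>pc := Suc (pc s), wmem := (wmem s)(i := wmem s (wmem s j))\<rparr>"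
| "exec (WStore i j) s = s\<lparr>pc := Suc (pc s), wmem := (wmem s)(wmem s i := wmem s j)\<rparr>"
| "exec (ROfWord i j) s = s\<lparr>pc := Suc (pc s), rmem := (rmem s)(i := real (wmem s j))\<rparr>"
| "exec (ROp f i j k) s =
     s\<lparr>pc := Suc (pc s), rmem := (rmem s)(i := eval_rop f (rmem s j) (rmem s k))\<rparr>"
| "exec (RLoad i j) s = s\<lparr>pc := Suc (pc s), rmem := (rmem s)(i := rmem s (wmem s j))\<rparr>"
| "exec (RStore i j) s = s\<lparr>pc := Suc (pc s), rmem := (rmem s)(wmem s i := rmem s j)\<rparr>"
| "exec (Jump l) s = s\<lparr>pc := l\<rparr>"
| "exec (WJumpLess i j l) s = s\<lparr>pc := (if wmem s i < wmem s j then l else Suc (pc s))\<rparr>"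
| "exec (RJumpLess i j l) s = s\<lparr>pc := (if rmem s i < rmem s j then l else Suc (pc s))\<rparr>"

definition halted :: "program \<Rightarrow> state \<Rightarrow> bool" where
  "halted P s \<longleftrightarrow> length P \<le> pc s"

definition step :: "program \<Rightarrow> state \<Rightarrow> state" where
  "step P s = (if halted P s then s else exec (P ! pc s) s)"

definition init_state :: "nat list \<Rightarrow> real list \<Rightarrow> state" where
  "init_state ws rs =
     \<lparr>pc = 0,
      wmem = (\<lambda>a. if a < length ws then ws ! a else 0),
      rmem = (\<lambda>a. if a < length rs then rs ! a else 0)\<rparr>"

text \<open>\<open>P\<close>, started in \<open>s\<close>, halts after at most \<open>t\<close> steps in \<open>s'\<close>, and no word ever
  exceeds \<open>b\<close>.\<close>

definition runs :: "program \<Rightarrow> nat \<Rightarrow> state \<Rightarrow> nat \<Rightarrow> state \<Rightarrow> bool" where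
  "runs P b s t s' \<longleftrightarrow>
     (step P ^^ t) s = s' \<and> halted P s' \<and> (\<forall>i\<le>t. \<forall>a. wmem ((step P ^^ i) s) a \<le> b)"

section \<open>Problems and algorithms\<close>

text \<open>\<open>param\<close> is the parameter (called \<open>n\<close>) in terms of which running times are measured.
  \<open>correct x y\<close> means that the word \<open>y\<close> is a correct output on instance \<open>x\<close>.\<close>

record 'i problem =
  instances :: "'i set"
  param :: "'i \<Rightarrow> nat"
  input_words :: "'i \<Rightarrow> nat list"
  input_reals :: "'i \<Rightarrow> real list"
  correct :: "'i \<Rightarrow> nat \<Rightarrow> bool"

text \<open>There is a program solving the problem in worst-case time \<open>O(f(n))\<close>, using words of
  \<open>O(log n)\<close> bits, i.e. of value at most \<open>(n + 2)^k\<close> for some constant \<open>k\<close>.  The output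
  is the content of word cell 0.\<close>

definition solvable_in :: "'i problem \<Rightarrow> (nat \<Rightarrow> real) \<Rightarrow> bool" where
  "solvable_in \<Pi> f \<longleftrightarrow>
     (\<exists>(P :: program) (k :: nat) (T :: nat \<Rightarrow> nat).
        (\<lambda>n. real (T n)) \<in> O(f) \<and>
        (\<forall>x\<in>instances \<Pi>. \<exists>s.
           runs P ((param \<Pi> x + 2) ^ k) (init_state (input_words \<Pi> x) (input_reals \<Pi> x))
             (T (param \<Pi> x)) s \<and>
           correct \<Pi> x (wmem s 0)))"

section \<open>The Hitting Set Conjecture\<close>

text \<open>The universe is \<open>{..<hs_univ x}\<close>; sets are given to the machine by their
  characteristic vectors.\<close>

record hs_instance =
  hs_univ :: nat
  hs_A :: "nat set list"
  hs_B :: "nat set list"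

definition hs_words :: "hs_instance \<Rightarrow> nat list" where
  "hs_words x =
     length (hs_A x) # hs_univ x #
     concat (map (\<lambda>X. map (\<lambda>u. if u \<in> X then 1 else 0) [0..<hs_univ x]) (hs_A x @ hs_B x))"

definition has_hitting_set :: "'a set list \<Rightarrow> 'a set list \<Rightarrow> bool" where
  "has_hitting_set As Bs \<longleftrightarrow> (\<exists>X\<in>set As. \<forall>Y\<in>set Bs. X \<inter> Y \<noteq> {})"

definition hitting_set_problem :: "real \<Rightarrow> hs_instance problem" where
  "hitting_set_problem c =
     \<lparr>instances = {x. length (hs_A x) \<ge> 1 \<and> length (hs_B x) = length (hs_A x) \<and>
                      (\<forall>X\<in>set (hs_A x) \<union> set (hs_B x). X \<subseteq> {..<hs_univ x}) \<and>
                      real (hs_univ x) \<le> c * log 2 (real (length (hs_A x)))},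
      param = (\<lambda>x. length (hs_A x)),
      input_words = hs_words,
      input_reals = (\<lambda>x. []),
      correct = (\<lambda>x y. y = (if has_hitting_set (hs_A x) (hs_B x) then 1 else 0))\<rparr>"

definition Hitting_Set_Conjecture :: bool where
  "Hitting_Set_Conjecture \<longleftrightarrow>
     \<not> (\<exists>\<epsilon>::real. \<epsilon> > 0 \<and>
          (\<forall>c\<ge>1. solvable_in (hitting_set_problem c) (\<lambda>n. real n powr (2 - \<epsilon>))))"

section \<open>Graphs and prioritized Voronoi diagrams\<close>

definition walk :: "'a set \<Rightarrow> 'a set set \<Rightarrow> 'a list \<Rightarrow> bool" where
  "walk V E p \<longleftrightarrow> p \<noteq> [] \<and> set p \<subseteq> V \<and> successively (\<lambda>u v. {u, v} \<in> E) p"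

definition simple_graph :: "'a set \<Rightarrow> 'a set set \<Rightarrow> bool" where
  "simple_graph V E \<longleftrightarrow> finite V \<and> (\<forall>e\<in>E. e \<subseteq> V \<and> card e = 2)"

definition connected_graph :: "'a set \<Rightarrow> 'a set set \<Rightarrow> bool" where
  "connected_graph V E \<longleftrightarrow>
     V \<noteq> {} \<and> (\<forall>u\<in>V. \<forall>v\<in>V. \<exists>p. walk V E p \<and> hd p = u \<and> last p = v)"

text \<open>Only meaningful if some walk joins \<open>u\<close> and \<open>v\<close>, hence for vertices of connected
  graphs.\<close>

definition gdist :: "'a set \<Rightarrow> 'a set set \<Rightarrow> 'a \<Rightarrow> 'a \<Rightarrow> nat" where
  "gdist V E u v = (LEAST k. \<exists>p. walk V E p \<and> hd p = u \<and> last p = v \<and> length p = Suc k)"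

definition gdist_list :: "'a set \<Rightarrow> 'a set set \<Rightarrow> 'a \<Rightarrow> 'a list \<Rightarrow> nat" where
  "gdist_list V E v S = Min (gdist V E v ` set S)"

definition proper_vertex_list :: "'a set \<Rightarrow> 'a list \<Rightarrow> bool" where
  "proper_vertex_list V S \<longleftrightarrow> S \<noteq> [] \<and> distinct S \<and> set S \<subseteq> V"

text \<open>List positions are counted from 0.\<close>

definition territory :: "'a set \<Rightarrow> 'a set set \<Rightarrow> 'a list \<Rightarrow> nat \<Rightarrow> 'a set" where
  "territory V E S i =
     {v\<in>V. gdist V E v (S ! i) = gdist_list V E v S \<and>
           (\<forall>j<i. gdist V E v (S ! j) > gdist_list V E v S)}"

definition load :: "'a set \<Rightarrow> 'a set set \<Rightarrow> ('a \<Rightarrow> real) \<Rightarrow> 'a list \<Rightarrow> nat \<Rightarrow> real" where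
  "load V E \<pi> S i = (\<Sum>v\<in>territory V E S i. \<pi> v)"

definition max_load :: "'a set \<Rightarrow> 'a set set \<Rightarrow> ('a \<Rightarrow> real) \<Rightarrow> 'a list \<Rightarrow> real" where
  "max_load V E \<pi> S = Max (load V E \<pi> S ` {..<length S})"

definition balanced_vertex :: "'a set \<Rightarrow> 'a set set \<Rightarrow> ('a \<Rightarrow> real) \<Rightarrow> 'a list \<Rightarrow> 'a \<Rightarrow> bool" where
  "balanced_vertex V E \<pi> S v \<longleftrightarrow>
     v \<in> V - set S \<and>
     (\<forall>u\<in>V - set S. max_load V E \<pi> (S @ [v]) \<le> max_load V E \<pi> (S @ [u]))"

section \<open>The Balanced Vertex problem\<close>

text \<open>The vertex set is \<open>{..<bv_n x}\<close>.  The graph is given to the machine as a list of its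
  edges, each edge occurring once, in either orientation.\<close>

record bv_instance =
  bv_n :: nat
  bv_edge_list :: "(nat \<times> nat) list"
  bv_cost :: "nat \<Rightarrow> real"
  bv_list :: "nat list"

definition bv_V :: "bv_instance \<Rightarrow> nat set" where
  "bv_V x = {..<bv_n x}"

definition bv_E :: "bv_instance \<Rightarrow> nat set set" where
  "bv_E x = (\<lambda>(u, v). {u, v}) ` set (bv_edge_list x)"

text \<open>An output exists only if \<open>S\<close> does not contain all vertices.\<close>

definition valid_bv_instance :: "bv_instance \<Rightarrow> bool" where
  "valid_bv_instance x \<longleftrightarrow>
     simple_graph (bv_V x) (bv_E x) \<and> connected_graph (bv_V x) (bv_E x) \<and>
     distinct (map (\<lambda>(u, v). {u, v}) (bv_edge_list x)) \<and>
     (\<forall>v\<in>bv_V x. bv_cost x v \<ge> 0) \<and>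
     proper_vertex_list (bv_V x) (bv_list x) \<and> bv_V x - set (bv_list x) \<noteq> {}"

definition bv_words :: "bv_instance \<Rightarrow> nat list" where
  "bv_words x =
     bv_n x # length (bv_edge_list x) # length (bv_list x) #
     concat (map (\<lambda>(u, v). [u, v]) (bv_edge_list x)) @ bv_list x"

definition balanced_vertex_problem :: "real \<Rightarrow> bv_instance problem" where
  "balanced_vertex_problem c =
     \<lparr>instances = {x. valid_bv_instance x \<and>
                      real (card (bv_E x)) \<le> c * real (bv_n x) * log 2 (real (bv_n x))},
      param = bv_n,
      input_words = bv_words,
      input_reals = (\<lambda>x. map (bv_cost x) [0..<bv_n x]),
      correct = (\<lambda>x v. balanced_vertex (bv_V x) (bv_E x) (bv_cost x) (bv_list x) v)\<rparr>"

end

(*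
  Reduction from Hitting Set.  Every set of A and every universe element becomes a vertex, as does
  every set of B; a root s, the only element of S, is adjacent to all sets of A, and membership gives
  the other edges.  Helper vertices place each set of B at distance exactly 3 from s.  A new vertex
  takes over from s the vertices that are strictly closer to it than to s, and since s is made so
  heavy that it always keeps the maximum load, a balanced vertex is one that takes over most cost.
  A set of A takes over itself (cost 2) and the sets of B that it meets (cost 2 each).  An additional
  neighbour z of s takes over exactly its own cost 2n + 1, and every other vertex takes over at most
  2n.  Hence a hitting set, which takes over 2n + 2, beats z, while without hitting sets z is the
  only balanced vertex.  With z = 0 the answer is read off the output without remembering the input,
  so the program for Balanced Vertex can run on the memory as it is, with shifted jump targets.
*)

theory Submission
  imports Defs
begin

section \<open>Structured RAM programs\<close>

text \<open>Distance 3 makes intersection visible: s loses a set of B exactly to the vertices within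
  distance 2 of it, and as no set of A is adjacent to a set of B, distance at most 2 between them
  means a common element. Cost 2 per set, rather than 1, leaves room for the odd value 2n + 1
  between 2n, the most that a set of A can take over if it misses some set of B, and 2n + 2. The
  machine is the harder obstacle. The given program is arbitrary and must find precisely its own
  initial memory: every cell outside its input must be 0, and no register can be set aside. So all
  that the preparation leaves behind has to be overwritten by the graph or cleared. As the universe
  has O(log n) elements, the graph has O(n) vertices and O(n log n) edges and is written in time O(n
  log n). This is within O(n^(2 - \<delta>)) if \<delta> \<le> 1/2, so the exponent gain is capped
  there. The density of the graph may depend on c, but \<delta> must not.\<close>

definition goes :: "program \<Rightarrow> nat \<Rightarrow> state \<Rightarrow> nat \<Rightarrow> state \<Rightarrow> bool" where
  "goes Q b s t s' \<longleftrightarrow> (step Q ^^ t) s = s' \<and> (\<forall>i\<le>t. \<forall>a. wmem ((step Q ^^ i) s) a \<le> b)"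

lemma goes_refl: "(\<And>a. wmem s a \<le> b) \<Longrightarrow> goes Q b s 0 s"
  by (simp add: goes_def)

lemma goes_bounded: "goes Q b s t s' \<Longrightarrow> wmem s' a \<le> b"
  by (auto simp: goes_def)

lemma goes_trans:
  assumes "goes Q b s t s'" "goes Q b s' t' s''"
  shows "goes Q b s (t + t') s''"
proof -
  have eq: "(step Q ^^ (j + t)) s = (step Q ^^ j) s'" for j
    using assms(1) by (simp add: goes_def funpow_add)
  have "wmem ((step Q ^^ i) s) a \<le> b" if "i \<le> t + t'" for i a
  proof (cases "i \<le> t")
    case True
    then show ?thesis using assms(1) by (simp add: goes_def)
  next
    case False
    then have "i = (i - t) + t" "i - t \<le> t'" using that by auto
    then show ?thesis using eq[of "i - t"] assms(2) by (simp add: goes_def)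
  qed
  then show ?thesis
    using eq[of t'] assms(2) by (simp add: goes_def add.commute)
qed

lemma goes_step:
  assumes "pc s < length Q" "exec (Q ! pc s) s = s'" "\<And>a. wmem s a \<le> b" "\<And>a. wmem s' a \<le> b"
  shows "goes Q b s 1 s'"
  using assms by (auto simp: goes_def step_def halted_def le_Suc_eq)

text \<open>A halted state is a fixed point of \<open>step\<close>, so the exact step count in
  \<open>runs\<close> can be padded up to any larger \<open>T\<close>.\<close>

lemma goes_runs:
  assumes "goes Q b s t s'" "halted Q s'" "t \<le> T"
  shows "runs Q b s T s'"
proof -
  have "step Q s' = s'" using assms(2) by (simp add: step_def)
  then have "(step Q ^^ j) s' = s'" for j
    by (induction j) auto
  moreover have "wmem s' a \<le> b" for a using assms(1) by (rule goes_bounded)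
  ultimately have "goes Q b s' (T - t) s'" by (simp add: goes_def)
  from goes_trans[OF assms(1) this] show ?thesis
    using assms by (simp add: goes_def runs_def)
qed

section \<open>Structured commands with timed Hoare triples\<close>

datatype cond = WLess nat nat | RLess nat nat

fun holds :: "cond \<Rightarrow> (nat \<Rightarrow> nat) \<Rightarrow> (nat \<Rightarrow> real) \<Rightarrow> bool" where
  "holds (WLess i j) w r \<longleftrightarrow> w i < w j"
| "holds (RLess i j) w r \<longleftrightarrow> r i < r j"

fun cond_jump :: "cond \<Rightarrow> nat \<Rightarrow> instr" where
  "cond_jump (WLess i j) l = WJumpLess i j l"
| "cond_jump (RLess i j) l = RJumpLess i j l"

datatype com = Blk "instr list" | Seq com com (infixr ";;" 60) | While cond com

fun csize :: "com \<Rightarrow> nat" where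
  "csize (Blk is) = length is"
| "csize (c ;; d) = csize c + csize d"
| "csize (While cd c) = csize c + 3"

text \<open>Jump targets are absolute, hence the start position \<open>p\<close>. The machine jumps
  only if a test succeeds, so a loop starts with a jump into the body at \<open>p + 2\<close>,
  followed by the exit jump that is reached if the test fails.\<close>

fun compile :: "nat \<Rightarrow> com \<Rightarrow> program" where
  "compile p (Blk is) = is"
| "compile p (c ;; d) = compile p c @ compile (p + csize c) d"
| "compile p (While cd c) =
     cond_jump cd (p + 2) # Jump (p + 3 + csize c) # compile (p + 2) c @ [Jump p]"

lemma length_compile [simp]: "length (compile p c) = csize c"
  by (induction c arbitrary: p) auto

text \<open>The invariant that no word exceeds \<open>b\<close> is implicit in both assertions.\<close>

definition triple ::
  "nat \<Rightarrow> ((nat \<Rightarrow> nat) \<Rightarrow> (nat \<Rightarrow> real) \<Rightarrow> bool) \<Rightarrow> com \<Rightarrow> nat \<Rightarrow> ((nat \<Rightarrow> nat) \<Rightarrow> (nat \<Rightarrow> real) \<Rightarrow> bool) \<Rightarrow> bool"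
where
  "triple b P c t R \<longleftrightarrow>
     (\<forall>xs ys s. pc s = length xs \<longrightarrow> P (wmem s) (rmem s) \<longrightarrow> (\<forall>a. wmem s a \<le> b) \<longrightarrow>
        (\<exists>t'\<le>t. \<exists>s'. goes (xs @ compile (length xs) c @ ys) b s t' s' \<and>
           pc s' = length xs + csize c \<and> R (wmem s') (rmem s')))"

lemma tripleE:
  assumes "triple b P c t R" "Q = xs @ compile (length xs) c @ ys" "pc s = length xs"
    "P (wmem s) (rmem s)" "\<And>a. wmem s a \<le> b"
  obtains t' s' where "t' \<le> t" "goes Q b s t' s'" "pc s' = length xs + csize c" "R (wmem s') (rmem s')"
  using assms unfolding triple_def by blast

lemma triple_conseq:
  assumes "triple b P c t R" "\<And>w r. P' w r \<Longrightarrow> P w r" "\<And>w r. R w r \<Longrightarrow> R' w r" "t \<le> t'"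
  shows "triple b P' c t' R'"
  using assms unfolding triple_def by (meson order_trans)

lemma triple_seq:
  assumes "triple b P c t R" "triple b R d t' U"
  shows "triple b P (c ;; d) (t + t') U"
  unfolding triple_def
proof (intro allI impI)
  fix xs ys :: program and s :: state
  assume s: "pc s = length xs" "P (wmem s) (rmem s)" "\<forall>a. wmem s a \<le> b"
  let ?Q = "xs @ compile (length xs) (c ;; d) @ ys"
  obtain t1 s1 where 1: "t1 \<le> t" "goes ?Q b s t1 s1" "pc s1 = length xs + csize c"
      "R (wmem s1) (rmem s1)"
    by (rule tripleE[OF assms(1), of ?Q xs "compile (length xs + csize c) d @ ys" s]) (use s in auto)
  obtain t2 s2 where 2: "t2 \<le> t'" "goes ?Q b s1 t2 s2"
      "pc s2 = length (xs @ compile (length xs) c) + csize d" "U (wmem s2) (rmem s2)"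
    by (rule tripleE[OF assms(2), of ?Q "xs @ compile (length xs) c" ys s1])
      (use 1 goes_bounded[OF 1(2)] in auto)
  show "\<exists>t''\<le>t + t'. \<exists>s'. goes ?Q b s t'' s' \<and>
           pc s' = length xs + csize (c ;; d) \<and> U (wmem s') (rmem s')"
    using goes_trans[OF 1(2) 2(2)] 1 2 by (intro exI[of _ "t1 + t2"] exI[of _ s2] conjI) auto
qed

lemma exec_cond_jump:
  "exec (cond_jump cd l) s = s\<lparr>pc := (if holds cd (wmem s) (rmem s) then l else Suc (pc s))\<rparr>"
  by (cases cd) auto

text \<open>The invariant is indexed by the round and decides the guard, so the number
  \<open>m\<close> of rounds is known in advance and yields termination and time together. A round
  pays 2 for the guard and the jump back, the end 2 for the failed guard and the exit jump.\<close>

lemma triple_while: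
  assumes body: "\<And>k. k < m \<Longrightarrow> triple b (I k) c t (I (Suc k))"
    and cond: "\<And>k w r. k \<le> m \<Longrightarrow> I k w r \<Longrightarrow> holds cd w r \<longleftrightarrow> k < m"
  shows "triple b (I 0) (While cd c) (m * (t + 2) + 2) (I m)"
  unfolding triple_def
proof (intro allI impI)
  fix xs ys :: program and s :: state
  assume s: "pc s = length xs" "I 0 (wmem s) (rmem s)" "\<forall>a. wmem s a \<le> b"
  let ?Q = "xs @ compile (length xs) (While cd c) @ ys"
  let ?p = "length xs"
  have "\<exists>t'\<le>j * (t + 2) + 2. \<exists>s'. goes ?Q b s t' s' \<and> pc s' = ?p + csize c + 3 \<and> I m (wmem s') (rmem s')"
    if "pc s = ?p" "I k (wmem s) (rmem s)" "\<forall>a. wmem s a \<le> b" "k + j = m" for j k s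
    using that
  proof (induction j arbitrary: k s)
    case 0
    have n: "\<not> holds cd (wmem s) (rmem s)" using cond 0 by auto
    have 1: "goes ?Q b s 1 (s\<lparr>pc := Suc ?p\<rparr>)"
      by (rule goes_step) (use n 0 in \<open>auto simp: exec_cond_jump\<close>)
    have 2: "goes ?Q b (s\<lparr>pc := Suc ?p\<rparr>) 1 (s\<lparr>pc := ?p + csize c + 3\<rparr>)"
      by (rule goes_step) (use 0 in \<open>auto simp: nth_append\<close>)
    show ?case using goes_trans[OF 1 2] 0
      by (intro exI[of _ "1 + 1"] exI[of _ "s\<lparr>pc := ?p + csize c + 3\<rparr>"] conjI) auto
  next
    case (Suc j)
    have h: "holds cd (wmem s) (rmem s)" using cond[of k] Suc.prems by simp
    let ?s1 = "s\<lparr>pc := ?p + 2\<rparr>"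
    have 1: "goes ?Q b s 1 ?s1"
      by (rule goes_step) (use h Suc.prems in \<open>auto simp: exec_cond_jump\<close>)
    obtain t2 s2 where 2: "t2 \<le> t" "goes ?Q b ?s1 t2 s2"
      "pc s2 = length (xs @ [cond_jump cd (?p + 2), Jump (?p + 3 + csize c)]) + csize c"
      "I (Suc k) (wmem s2) (rmem s2)"
      by (rule tripleE[OF body, of k ?Q "xs @ [cond_jump cd (?p + 2), Jump (?p + 3 + csize c)]"
            "[Jump ?p] @ ys" ?s1])
        (use Suc.prems in auto)
    let ?s3 = "s2\<lparr>pc := ?p\<rparr>"
    have 3: "goes ?Q b s2 1 ?s3"
      by (rule goes_step) (use 2 goes_bounded[OF 2(2)] in \<open>auto simp: nth_append\<close>)
    obtain t4 s4 where 4: "t4 \<le> j * (t + 2) + 2" "goes ?Q b ?s3 t4 s4" "pc s4 = ?p + csize c + 3"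
        "I m (wmem s4) (rmem s4)"
      using Suc.IH[of ?s3 "Suc k"] 2 goes_bounded[OF 2(2)] Suc.prems by auto
    have "goes ?Q b s (1 + (t2 + (1 + t4))) s4"
      using 1 2(2) 3 4(2) by (blast intro: goes_trans)
    then show ?case using 2 4 by (intro exI[of _ "1 + (t2 + (1 + t4))"] exI[of _ s4] conjI) auto
  qed
  from this[of s 0 m] show "\<exists>t'\<le>m * (t + 2) + 2. \<exists>s'. goes ?Q b s t' s' \<and>
      pc s' = length xs + csize (While cd c) \<and> I m (wmem s') (rmem s')"
    using s by (auto simp: add.assoc)
qed

text \<open>Only \<open>Const\<close> and \<open>WOp\<close> can create a new word value; the others
  copy words that already obey the bound and so owe no proof of it. Jumps are ruled out because
  blocks are straight-line code.\<close>

fun wp_instr ::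
  "nat \<Rightarrow> instr \<Rightarrow> ((nat \<Rightarrow> nat) \<Rightarrow> (nat \<Rightarrow> real) \<Rightarrow> bool) \<Rightarrow> (nat \<Rightarrow> nat) \<Rightarrow> (nat \<Rightarrow> real) \<Rightarrow> bool"
where
  "wp_instr b (Const i c) R w r \<longleftrightarrow> c \<le> b \<and> R (w(i := c)) r"
| "wp_instr b (WOp f i j k) R w r \<longleftrightarrow>
     eval_wop f (w j) (w k) \<le> b \<and> R (w(i := eval_wop f (w j) (w k))) r"
| "wp_instr b (WLoad i j) R w r \<longleftrightarrow> R (w(i := w (w j))) r"
| "wp_instr b (WStore i j) R w r \<longleftrightarrow> R (w(w i := w j)) r"
| "wp_instr b (ROfWord i j) R w r \<longleftrightarrow> R w (r(i := real (w j)))"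
| "wp_instr b (ROp f i j k) R w r \<longleftrightarrow> R w (r(i := eval_rop f (r j) (r k)))"
| "wp_instr b (RLoad i j) R w r \<longleftrightarrow> R w (r(i := r (w j)))"
| "wp_instr b (RStore i j) R w r \<longleftrightarrow> R w (r(w i := r j))"
| "wp_instr b (Jump l) R w r \<longleftrightarrow> False"
| "wp_instr b (WJumpLess i j l) R w r \<longleftrightarrow> False"
| "wp_instr b (RJumpLess i j l) R w r \<longleftrightarrow> False"

fun wp ::
  "nat \<Rightarrow> instr list \<Rightarrow> ((nat \<Rightarrow> nat) \<Rightarrow> (nat \<Rightarrow> real) \<Rightarrow> bool) \<Rightarrow> (nat \<Rightarrow> nat) \<Rightarrow> (nat \<Rightarrow> real) \<Rightarrow> bool"
where
  "wp b [] R w r \<longleftrightarrow> R w r"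
| "wp b (i # is) R w r \<longleftrightarrow> wp_instr b i (wp b is R) w r"

lemma wp_instr_exec:
  assumes "wp_instr b i R (wmem s) (rmem s)" "\<And>a. wmem s a \<le> b"
  shows "pc (exec i s) = Suc (pc s) \<and> R (wmem (exec i s)) (rmem (exec i s)) \<and> (\<forall>a. wmem (exec i s) a \<le> b)"
  using assms by (cases i) auto

lemma wp_goes:
  assumes "wp b is R (wmem s) (rmem s)" "pc s = length xs" "\<And>a. wmem s a \<le> b"
  shows "\<exists>s'. goes (xs @ is @ ys) b s (length is) s' \<and> pc s' = length xs + length is \<and>
           R (wmem s') (rmem s')"
  using assms
proof (induction "is" arbitrary: s xs)
  case Nil
  then show ?case by (intro exI[of _ s] conjI) (auto intro: goes_refl)
next
  case (Cons i "is")
  let ?s = "exec i s"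
  have e: "pc ?s = Suc (pc s)" "wp b is R (wmem ?s) (rmem ?s)" "\<And>a. wmem ?s a \<le> b"
    using wp_instr_exec[of b i "wp b is R" s] Cons.prems by auto
  have 1: "goes (xs @ (i # is) @ ys) b s 1 ?s"
    by (rule goes_step) (use e Cons.prems in auto)
  obtain s' where "goes ((xs @ [i]) @ is @ ys) b ?s (length is) s'"
     "pc s' = length (xs @ [i]) + length is" "R (wmem s') (rmem s')"
    using Cons.IH[of ?s "xs @ [i]"] e Cons.prems by auto
  then show ?case using goes_trans[OF 1, of "length is" s'] by (intro exI[of _ s']) auto
qed

lemma triple_blk:
  assumes "\<And>w r. P w r \<Longrightarrow> (\<And>a. w a \<le> b) \<Longrightarrow> wp b is R w r"
  shows "triple b P (Blk is) (length is) R"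
  unfolding triple_def using wp_goes assms by (metis compile.simps(1) csize.simps(1) order_refl)

text \<open>Jumps beyond the end of a program of length \<open>l\<close> halt it; here they must fall through.\<close>

fun relocate :: "nat \<Rightarrow> nat \<Rightarrow> instr \<Rightarrow> instr" where
  "relocate p l (Jump j) = Jump (p + min j l)"
| "relocate p l (WJumpLess i k j) = WJumpLess i k (p + min j l)"
| "relocate p l (RJumpLess i k j) = RJumpLess i k (p + min j l)"
| "relocate p l i = i"

lemma exec_relocate:
  assumes "pc s < l"
  shows "exec (relocate p l i) (s\<lparr>pc := p + min (pc s) l\<rparr>) =
     (exec i s)\<lparr>pc := p + min (pc (exec i s)) l\<rparr>"
  using assms by (cases i) auto

text \<open>Both programs move in lockstep under the shift of the program counter. Steps that
  \<open>P\<close> spends in a halted state have no counterpart, hence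
  \<open>t' \<le> t\<close>.\<close>

lemma runs_relocate:
  assumes "runs P b s t s'"
  shows "\<exists>t'\<le>t. goes (xs @ map (relocate (length xs) (length P)) P @ ys) b
     (s\<lparr>pc := length xs + min (pc s) (length P)\<rparr>) t'
     (s'\<lparr>pc := length xs + length P\<rparr>)"
  using assms
proof (induction t arbitrary: s)
  case 0
  then show ?case by (auto simp: runs_def goes_def halted_def min_def)
next
  case (Suc t)
  let ?Q = "xs @ map (relocate (length xs) (length P)) P @ ys"
  let ?f = "\<lambda>s. s\<lparr>pc := length xs + min (pc s) (length P)\<rparr>"
  have r: "(step P ^^ t) (step P s) = s'" "halted P s'"
    "\<And>i a. i \<le> Suc t \<Longrightarrow> wmem ((step P ^^ i) s) a \<le> b"
    using Suc.prems by (auto simp: runs_def funpow_swap1)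
  have "runs P b (step P s) t s'"
    unfolding runs_def
  proof (intro conjI allI impI)
    fix i a assume "i \<le> t"
    then show "wmem ((step P ^^ i) (step P s)) a \<le> b"
      using r(3)[of "Suc i" a] by (simp add: funpow_swap1)
  qed (use r in auto)
  then obtain t' where t': "t' \<le> t" "goes ?Q b (?f (step P s)) t' (s'\<lparr>pc := length xs + length P\<rparr>)"
    using Suc.IH by auto
  show ?case
  proof (cases "halted P s")
    case True
    then show ?thesis using t' by (auto simp: step_def intro: exI[of _ t'])
  next
    case False
    then have l: "pc s < length P" by (simp add: halted_def)
    have "goes ?Q b (?f s) 1 (?f (step P s))"
    proof (rule goes_step)
      show "exec (?Q ! pc (?f s)) (?f s) = ?f (step P s)"
        using l exec_relocate[OF l, of "length xs" "P ! pc s"] False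
        by (simp add: nth_append step_def)
      show "wmem (?f s) a \<le> b" for a using r(3)[of 0 a] by simp
      show "wmem (?f (step P s)) a \<le> b" for a using r(3)[of 1 a] by simp
    qed (use l in auto)
    from goes_trans[OF this t'(2)] show ?thesis using t'(1) by (intro exI[of _ "1 + t'"]) auto
  qed
qed

section \<open>The graph of a Hitting Set instance\<close>

lemma walk_singleton: "v \<in> V \<Longrightarrow> walk V E [v]"
  by (simp add: walk_def)

lemma walk_Cons: "walk V E p \<Longrightarrow> v \<in> V \<Longrightarrow> {v, hd p} \<in> E \<Longrightarrow> walk V E (v # p)"
  by (cases p) (auto simp: walk_def)

lemma walk_rev: "walk V E p \<Longrightarrow> walk V E (rev p)"
  by (simp add: walk_def successively_rev insert_commute)

lemma walk_append_tl:
  assumes "walk V E p" "walk V E q" "last p = hd q"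
  shows "walk V E (p @ tl q)"
proof (cases q)
  case (Cons y ys)
  then show ?thesis using assms
    by (cases ys) (auto simp: walk_def successively_append_iff)
qed (use assms in \<open>simp add: walk_def\<close>)

lemma last_append_tl: "p \<noteq> [] \<Longrightarrow> q \<noteq> [] \<Longrightarrow> last p = hd q \<Longrightarrow> last (p @ tl q) = last q"
  by (cases q) auto

lemma gdist_le: "walk V E p \<Longrightarrow> hd p = u \<Longrightarrow> last p = v \<Longrightarrow> length p = Suc k \<Longrightarrow> gdist V E u v \<le> k"
  unfolding gdist_def by (rule Least_le) blast

lemma gdist_walk:
  assumes "connected_graph V E" "u \<in> V" "v \<in> V"
  shows "\<exists>p. walk V E p \<and> hd p = u \<and> last p = v \<and> length p = Suc (gdist V E u v)"
proof -
  obtain p where p: "walk V E p" "hd p = u" "last p = v"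
    using assms unfolding connected_graph_def by blast
  then have "length p = Suc (length p - 1)" by (cases p) (auto simp: walk_def)
  then have "\<exists>k p. walk V E p \<and> hd p = u \<and> last p = v \<and> length p = Suc k" using p by blast
  then show ?thesis unfolding gdist_def by (rule LeastI_ex)
qed

text \<open>A local certificate for connectedness and for all distances from \<open>root\<close>:
  parents give a walk of length \<open>lev v\<close>, and since an edge changes the level by at most
  1, no walk is shorter.\<close>

locale layered_graph =
  fixes V :: "'a set" and E :: "'a set set" and root :: 'a and lev :: "'a \<Rightarrow> nat"
  assumes finite_V: "finite V"
    and root_in: "root \<in> V"
    and lev_root: "lev root = 0"
    and lev_edge: "{u, v} \<in> E \<Longrightarrow> lev u \<le> Suc (lev v)"
    and parent: "v \<in> V \<Longrightarrow> v \<noteq> root \<Longrightarrow> \<exists>y\<in>V. {v, y} \<in> E \<and> lev v = Suc (lev y)"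
begin

lemma walk_to_root: "v \<in> V \<Longrightarrow> \<exists>p. walk V E p \<and> hd p = v \<and> last p = root \<and> length p = Suc (lev v)"
proof (induction "lev v" arbitrary: v)
  case 0
  then have "v = root" using parent[of v] by fastforce
  then show ?case using root_in lev_root by (intro exI[of _ "[root]"]) (simp add: walk_singleton)
next
  case (Suc k)
  then have "v \<noteq> root" using lev_root by auto
  then obtain y where y: "y \<in> V" "{v, y} \<in> E" "lev v = Suc (lev y)" using parent Suc by blast
  then obtain p where p: "walk V E p" "hd p = y" "last p = root" "length p = Suc (lev y)"
    using Suc by force
  have "p \<noteq> []" using p by (auto simp: walk_def)
  then show ?case using walk_Cons[OF p(1) \<open>v \<in> V\<close>] p y by (intro exI[of _ "v # p"]) auto
qed

lemma connected: "connected_graph V E"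
  unfolding connected_graph_def
proof (intro conjI ballI)
  show "V \<noteq> {}" using root_in by auto
  fix u v assume uv: "u \<in> V" "v \<in> V"
  obtain p q where p: "walk V E p" "hd p = u" "last p = root"
    and q: "walk V E q" "hd q = v" "last q = root"
    using walk_to_root[OF uv(1)] walk_to_root[OF uv(2)] by blast
  have ne: "p \<noteq> []" "q \<noteq> []" using p q by (auto simp: walk_def)
  have "walk V E (p @ tl (rev q))"
    by (rule walk_append_tl[OF p(1) walk_rev[OF q(1)]]) (use p q ne in \<open>simp add: hd_rev\<close>)
  moreover have "last (p @ tl (rev q)) = v"
    using p q ne last_append_tl[of p "rev q"] by (simp add: hd_rev last_rev)
  ultimately show "\<exists>p. walk V E p \<and> hd p = u \<and> last p = v"
    using p ne by (intro exI[of _ "p @ tl (rev q)"]) auto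
qed

lemma lev_walk: "walk V E p \<Longrightarrow> lev (hd p) < lev (last p) + length p"
proof (induction p)
  case (Cons x p)
  then show ?case
    using lev_edge[of x "hd p"] by (cases p) (auto simp: walk_def)
qed (simp add: walk_def)

lemma lev_le_gdist:
  assumes "u \<in> V" "v \<in> V"
  shows "lev u \<le> lev v + gdist V E u v"
  using gdist_walk[OF connected assms] lev_walk by fastforce

lemma gdist_root: "v \<in> V \<Longrightarrow> gdist V E v root = lev v"
  using walk_to_root[of v] gdist_le lev_le_gdist[of v root] root_in lev_root
  by (metis add_0 le_antisym)

text \<open>Ties stay with \<open>root\<close>, which comes first in the list, hence the strict
  inequality.\<close>

definition stolen :: "('a \<Rightarrow> real) \<Rightarrow> 'a \<Rightarrow> real" where
  "stolen \<pi> v = sum \<pi> {x \<in> V. gdist V E x v < lev x}"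

text \<open>By \<open>small\<close> the new vertex gets at most half of the total cost, so the
  maximum is what \<open>root\<close> keeps.\<close>

lemma max_load_eq:
  assumes v: "v \<in> V" and small: "2 * stolen \<pi> v \<le> sum \<pi> V"
  shows "max_load V E \<pi> [root, v] = sum \<pi> V - stolen \<pi> v"
proof -
  let ?T = "{x \<in> V. gdist V E x v < lev x}"
  have g: "gdist_list V E x [root, v] = min (lev x) (gdist V E x v)" if "x \<in> V" for x
    using gdist_root that by (auto simp: gdist_list_def min.commute)
  have t0: "territory V E [root, v] 0 = V - ?T"
    using g gdist_root by (auto simp: territory_def)
  have t1: "territory V E [root, v] 1 = ?T"
    using g gdist_root by (auto simp: territory_def)
  have l0: "load V E \<pi> [root, v] 0 = sum \<pi> V - stolen \<pi> v"
    unfolding load_def t0 stolen_def by (rule sum_diff) (auto simp: finite_V)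
  have l1: "load V E \<pi> [root, v] 1 = stolen \<pi> v"
    unfolding load_def t1 stolen_def ..
  have "{..<length [root, v]} = {0, 1}" by auto
  then show ?thesis
    unfolding max_load_def using l0 l1 small by simp
qed

lemma balanced_vertex_iff:
  assumes small: "\<And>v. v \<in> V - {root} \<Longrightarrow> 2 * stolen \<pi> v \<le> sum \<pi> V"
  shows "balanced_vertex V E \<pi> [root] v \<longleftrightarrow>
     v \<in> V - {root} \<and> (\<forall>u\<in>V - {root}. stolen \<pi> u \<le> stolen \<pi> v)"
  using max_load_eq small by (fastforce simp: balanced_vertex_def)

end

text \<open>
  The bit of row \<open>r\<close> (a set of \<open>A\<close> if \<open>r < n\<close>, else a set of \<open>B\<close>) at position
  \<open>k\<close> always yields exactly one edge: to a common vertex if it is 1, and otherwise to a vertex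
  that only rows from the same list can reach.  So the number of edges does not depend on the input
  bits, and the bits can be replaced by edges without compaction.
\<close>

definition slot :: "nat \<Rightarrow> nat \<Rightarrow> (nat \<Rightarrow> nat set) \<Rightarrow> nat \<Rightarrow> nat \<Rightarrow> nat" where
  "slot n u X r k = (if k \<in> X r then k else if r < n then u + k else 2 * u + k)"

text \<open>
  Vertex 0 is the candidate that wins if there is no hitting set, \<open>6 + r\<close> is row \<open>r\<close>,
  \<open>6 + 2 * n + k\<close> is the universe vertex \<open>k \<le> 3 * u\<close> (the last one is adjacent to all
  sets of \<open>B\<close>), \<open>7 + 2 * n + 3 * u\<close> is adjacent to all universe vertices, and
  \<open>8 + 2 * n + 3 * u\<close> is the only element of the list \<open>S\<close>.  The leaves 1 to 5 exist only
  because their constant edges end up in the word cells that the reduction uses as registers.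
\<close>

definition hs_edges :: "nat \<Rightarrow> nat \<Rightarrow> (nat \<Rightarrow> nat set) \<Rightarrow> (nat \<times> nat) list" where
  "hs_edges n u X =
     map (\<lambda>i. (0, Suc i)) [0..<5] @
     map (\<lambda>t. (6 + t div u, 6 + 2 * n + slot n u X (t div u) (t mod u))) [0..<2 * n * u] @
     map (\<lambda>r. (6 + r, if r < n then 8 + 2 * n + 3 * u else 6 + 2 * n + 3 * u)) [0..<2 * n] @
     map (\<lambda>k. (6 + 2 * n + k, 7 + 2 * n + 3 * u)) [0..<3 * u + 1] @
     [(0, 8 + 2 * n + 3 * u), (7 + 2 * n + 3 * u, 8 + 2 * n + 3 * u)]"

text \<open>The root costs \<open>2 * n + 2\<close>, the most that any vertex can take over, so
  together with the cost that stays behind it always keeps at least half of the total.\<close>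

definition hs_cost :: "nat \<Rightarrow> nat \<Rightarrow> nat \<Rightarrow> real" where
  "hs_cost n u v =
     (if v = 0 then real (2 * n + 1) else if 6 \<le> v \<and> v < 6 + 2 * n then 2
      else if v = 8 + 2 * n + 3 * u then real (2 * n + 2) else 0)"

definition hs_lev :: "nat \<Rightarrow> nat \<Rightarrow> nat \<Rightarrow> nat" where
  "hs_lev n u v =
     (if v = 0 then 1 else if v < 6 then 2 else if v < 6 + n then 1 else if v < 6 + 2 * n then 3
      else if v \<le> 6 + 2 * n + 3 * u then 2 else if v = 7 + 2 * n + 3 * u then 1 else 0)"

definition hs_to_bv :: "nat \<Rightarrow> nat \<Rightarrow> (nat \<Rightarrow> nat set) \<Rightarrow> bv_instance" where
  "hs_to_bv n u X =
     \<lparr>bv_n = 9 + 2 * n + 3 * u, bv_edge_list = hs_edges n u X, bv_cost = hs_cost n u,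
      bv_list = [8 + 2 * n + 3 * u]\<rparr>"

section \<open>The edge list, its levels and connectedness\<close>

lemma slot_le: "k < u \<Longrightarrow> slot n u X r k < 3 * u"
  by (auto simp: slot_def)

lemma slot_inj: "k < u \<Longrightarrow> k' < u \<Longrightarrow> slot n u X r k = slot n u X r k' \<Longrightarrow> k = k'"
  by (auto simp: slot_def split: if_splits)

lemma length_hs_edges: "length (hs_edges n u X) = 8 + 2 * n * u + 2 * n + 3 * u"
  by (simp add: hs_edges_def)

text \<open>The single index \<open>t\<close> runs through the bits row by row, as the loop of the
  machine does; the pairs \<open>(r, k)\<close> are the form that suits arguments about the
  graph.\<close>

lemma hs_edges_bits:
  "(\<lambda>t. (6 + t div u, 6 + 2 * n + slot n u X (t div u) (t mod u))) ` {0..<2 * n * u} =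
   {(6 + r, 6 + 2 * n + slot n u X r k) | r k. r < 2 * n \<and> k < u}"
proof (intro equalityI subsetI)
  fix e assume "e \<in> (\<lambda>t. (6 + t div u, 6 + 2 * n + slot n u X (t div u) (t mod u))) ` {0..<2 * n * u}"
  then obtain t where t: "t < 2 * n * u"
    "e = (6 + t div u, 6 + 2 * n + slot n u X (t div u) (t mod u))" by auto
  then have "u > 0" "t div u < 2 * n" by (auto simp: less_mult_imp_div_less intro!: gr0I)
  then show "e \<in> {(6 + r, 6 + 2 * n + slot n u X r k) | r k. r < 2 * n \<and> k < u}"
    using t(2) by (auto intro!: exI[of _ "t div u"] exI[of _ "t mod u"])
next
  fix e assume "e \<in> {(6 + r, 6 + 2 * n + slot n u X r k) | r k. r < 2 * n \<and> k < u}"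
  then obtain r k where e: "e = (6 + r, 6 + 2 * n + slot n u X r k)" "r < 2 * n" "k < u" by auto
  have "r * u + k < (r + 1) * u" using e by simp
  also have "\<dots> \<le> 2 * n * u" using e by (intro mult_le_mono1) simp
  finally show "e \<in> (\<lambda>t. (6 + t div u, 6 + 2 * n + slot n u X (t div u) (t mod u))) ` {0..<2 * n * u}"
    using e by (intro image_eqI[of _ _ "r * u + k"]) auto
qed

lemma set_hs_edges:
  "set (hs_edges n u X) =
     {(0, Suc i) | i. i < 5} \<union>
     {(6 + r, 6 + 2 * n + slot n u X r k) | r k. r < 2 * n \<and> k < u} \<union>
     {(6 + r, if r < n then 8 + 2 * n + 3 * u else 6 + 2 * n + 3 * u) | r. r < 2 * n} \<union>
     {(6 + 2 * n + k, 7 + 2 * n + 3 * u) | k. k < 3 * u + 1} \<union>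
     {(0, 8 + 2 * n + 3 * u), (7 + 2 * n + 3 * u, 8 + 2 * n + 3 * u)}"
  unfolding hs_edges_def set_append set_map set_upt hs_edges_bits by auto

lemma bit_edge:
  "r < 2 * n \<Longrightarrow> k < u \<Longrightarrow> (6 + r, 6 + 2 * n + slot n u X r k) \<in> set (hs_edges n u X)"
  unfolding set_hs_edges by blast

lemma hs_edges_ordered:
  assumes "(x, y) \<in> set (hs_edges n u X)"
  shows "x < y \<and> y < 9 + 2 * n + 3 * u"
proof -
  have "6 + r < 6 + 2 * n + slot n u X r k \<and> 6 + 2 * n + slot n u X r k < 9 + 2 * n + 3 * u"
    if "r < 2 * n" "k < u" for r k
    using that slot_le[of k u n X r] by linarith
  then show ?thesis using assms unfolding set_hs_edges by (auto split: if_splits)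
qed

text \<open>The groups differ in their endpoints: leaf edges end below 6, bit edges start at 6 or
  later and end below \<open>6 + 2 * n + 3 * u\<close>, and each later edge ends at or beyond that
  vertex or starts at 0 and ends at 8 or later.\<close>

lemma distinct_hs_edges: "distinct (hs_edges n u X)"
proof -
  let ?f = "\<lambda>t. (6 + t div u, 6 + 2 * n + slot n u X (t div u) (t mod u))"
  have "inj_on ?f {0..<2 * n * u}"
  proof (rule inj_onI)
    fix t t' assume t: "t \<in> {0..<2 * n * u}" "t' \<in> {0..<2 * n * u}" and eq: "?f t = ?f t'"
    have "u > 0" using t by (auto intro!: gr0I)
    then have "t mod u = t' mod u" using eq slot_inj[of "t mod u" u "t' mod u"] by auto
    then show "t = t'" using eq by (metis Pair_inject add_left_cancel div_mult_mod_eq)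
  qed
  then have 2: "distinct (map ?f [0..<2 * n * u])" by (simp add: distinct_map)
  show ?thesis
    unfolding hs_edges_def distinct_append
  proof (intro conjI)
    show "distinct (map ?f [0..<2 * n * u])" by (rule 2)
  next
    have "6 + 2 * n + slot n u X r k < 6 + 2 * n + 3 * u \<and> 6 + r < 6 + 2 * n"
      if "r < 2 * n" "k < u" for r k
      using that slot_le[of k u n X r] by linarith
    then have bits: "y < 6 + 2 * n + 3 * u \<and> 6 \<le> x \<and> x < 6 + 2 * n"
      if "(x, y) \<in> set (map ?f [0..<2 * n * u])" for x y
      using that unfolding set_map set_upt hs_edges_bits by auto
    let ?C = "map (\<lambda>r. (6 + r, if r < n then 8 + 2 * n + 3 * u else 6 + 2 * n + 3 * u)) [0..<2 * n]
      @ map (\<lambda>k. (6 + 2 * n + k, 7 + 2 * n + 3 * u)) [0..<3 * u + 1]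
      @ [(0, 8 + 2 * n + 3 * u), (7 + 2 * n + 3 * u, 8 + 2 * n + 3 * u)]"
    have C: "x = 0 \<and> y \<ge> 8 \<or> 6 \<le> x \<and> y \<ge> 6 + 2 * n + 3 * u"
      if "(x, y) \<in> set ?C" for x y
      using that by (auto split: if_splits)
    have "e \<notin> set ?C" if "e \<in> set (map ?f [0..<2 * n * u])" for e
    proof (cases e)
      case (Pair x y)
      have b: "(x, y) \<in> set (map ?f [0..<2 * n * u])" using that unfolding Pair .
      show ?thesis
      proof
        assume "e \<in> set ?C"
        then have "(x, y) \<in> set ?C" unfolding Pair .
        from C[OF this] bits[OF b] show False by linarith
      qed
    qed
    then show "set (map ?f [0..<2 * n * u]) \<inter> set ?C = {}" by blast
    have "e \<notin> set (map (\<lambda>i. (0, Suc i)) [0..<5])" if "e \<in> set (map ?f [0..<2 * n * u] @ ?C)" for e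
    proof (cases e)
      case (Pair x y)
      then have "(x, y) \<in> set (map ?f [0..<2 * n * u]) \<or> (x, y) \<in> set ?C"
        using that by (simp only: set_append Un_iff)
      then have "6 \<le> x \<or> 8 \<le> y" using bits[of x y] C[of x y] by linarith
      then show ?thesis using Pair by (auto simp del: upt_Suc)
    qed
    then show "set (map (\<lambda>i. (0, Suc i)) [0..<5]) \<inter> set (map ?f [0..<2 * n * u] @ ?C) = {}"
      by blast
  qed (auto simp: distinct_map inj_on_def simp del: upt_Suc split: if_splits)
qed


definition hs_E :: "nat \<Rightarrow> nat \<Rightarrow> (nat \<Rightarrow> nat set) \<Rightarrow> nat set set" where
  "hs_E n u X = (\<lambda>(x, y). {x, y}) ` set (hs_edges n u X)"

lemma hs_E_iff: "{x, y} \<in> hs_E n u X \<longleftrightarrow> (x, y) \<in> set (hs_edges n u X) \<or> (y, x) \<in> set (hs_edges n u X)"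
  by (force simp: hs_E_def doubleton_eq_iff)

lemma distinct_hs_E: "distinct (map (\<lambda>(x, y). {x, y}) (hs_edges n u X))"
  unfolding distinct_map
proof (intro conjI distinct_hs_edges inj_onI)
  fix e e' assume e: "e \<in> set (hs_edges n u X)" "e' \<in> set (hs_edges n u X)"
    "(case e of (x, y) \<Rightarrow> {x, y}) = (case e' of (x, y) \<Rightarrow> {x, y})"
  obtain x y x' y' where xy: "e = (x, y)" "e' = (x', y')" by (cases e, cases e')
  have "x < y" "x' < y'" using e xy hs_edges_ordered by blast+
  then show "e = e'" using e(3) xy by (auto simp: doubleton_eq_iff)
qed

lemma hs_lev_edge:
  assumes "(x, y) \<in> set (hs_edges n u X)"
  shows "hs_lev n u x \<le> Suc (hs_lev n u y) \<and> hs_lev n u y \<le> Suc (hs_lev n u x)"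
proof -
  have "slot n u X r k \<le> 3 * u \<and> slot n u X r k \<noteq> Suc (3 * u)" if "k < u" for r k
    using slot_le[OF that, of n X r] by simp
  then show ?thesis using assms unfolding set_hs_edges by (auto simp: hs_lev_def split: if_splits)
qed

lemma hs_parent:
  assumes "v < 8 + 2 * n + 3 * u"
  shows "\<exists>y<9 + 2 * n + 3 * u. {v, y} \<in> hs_E n u X \<and> hs_lev n u v = Suc (hs_lev n u y)"
proof -
  consider "v = 0" | "1 \<le> v" "v < 6" | "6 \<le> v" "v < 6 + n" | "6 + n \<le> v" "v < 6 + 2 * n"
    | "6 + 2 * n \<le> v" "v \<le> 6 + 2 * n + 3 * u" | "v = 7 + 2 * n + 3 * u"
    using assms by linarith
  then show ?thesis
  proof cases
    case 1
    then show ?thesis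
      by (intro exI[of _ "8 + 2 * n + 3 * u"]) (simp add: hs_E_iff set_hs_edges hs_lev_def)
  next
    case 2
    then have "(0, v) \<in> set (hs_edges n u X)" unfolding set_hs_edges
      by (auto intro: exI[of _ "v - 1"])
    then show ?thesis using 2 by (intro exI[of _ 0]) (simp add: hs_E_iff hs_lev_def)
  next
    case 3
    then have "(v, 8 + 2 * n + 3 * u) \<in> set (hs_edges n u X)" unfolding set_hs_edges
      by (auto intro: exI[of _ "v - 6"])
    then show ?thesis using 3
      by (intro exI[of _ "8 + 2 * n + 3 * u"]) (simp add: hs_E_iff hs_lev_def)
  next
    case 4
    then have "(v, 6 + 2 * n + 3 * u) \<in> set (hs_edges n u X)" unfolding set_hs_edges
      by (auto intro: exI[of _ "v - 6"])
    then show ?thesis using 4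
      by (intro exI[of _ "6 + 2 * n + 3 * u"]) (simp add: hs_E_iff hs_lev_def)
  next
    case 5
    then have "(v, 7 + 2 * n + 3 * u) \<in> set (hs_edges n u X)" unfolding set_hs_edges
      by (auto intro: exI[of _ "v - (6 + 2 * n)"])
    then show ?thesis using 5
      by (intro exI[of _ "7 + 2 * n + 3 * u"]) (simp add: hs_E_iff hs_lev_def)
  next
    case 6
    then show ?thesis
      by (intro exI[of _ "8 + 2 * n + 3 * u"]) (simp add: hs_E_iff set_hs_edges hs_lev_def)
  qed
qed

interpretation hs: layered_graph "{..<9 + 2 * n + 3 * u}" "hs_E n u X" "8 + 2 * n + 3 * u" "hs_lev n u"
  for n u X
proof
  show "hs_lev n u x \<le> Suc (hs_lev n u y)" if "{x, y} \<in> hs_E n u X" for x y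
    using that hs_lev_edge unfolding hs_E_iff by blast
  show "\<exists>y\<in>{..<9 + 2 * n + 3 * u}. {v, y} \<in> hs_E n u X \<and> hs_lev n u v = Suc (hs_lev n u y)"
    if "v \<in> {..<9 + 2 * n + 3 * u}" "v \<noteq> 8 + 2 * n + 3 * u" for v
    using hs_parent[of v n u X] that by auto
qed (auto simp: hs_lev_def)

section \<open>Distances from the sets of B\<close>

lemma hs_nbr_A:
  assumes "{6 + r, y} \<in> hs_E n u X" "r < n"
  shows "y = 8 + 2 * n + 3 * u \<or> (\<exists>k<u. y = 6 + 2 * n + slot n u X r k)"
  using assms unfolding hs_E_iff set_hs_edges by (auto split: if_splits)

lemma hs_nbr_B:
  assumes "{6 + n + r, y} \<in> hs_E n u X" "r < n"
  shows "y = 6 + 2 * n + 3 * u \<or> (\<exists>k<u. y = 6 + 2 * n + slot n u X (n + r) k)"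
  using assms unfolding hs_E_iff set_hs_edges by (auto split: if_splits)

lemma hs_nbr_0:
  assumes "{y, 0} \<in> hs_E n u X"
  shows "y < 6 \<or> y = 8 + 2 * n + 3 * u"
  using assms unfolding hs_E_iff set_hs_edges by (auto split: if_splits)

text \<open>The positions from \<open>u\<close> on are reached only from sets of A, those from
  \<open>2 * u\<close> on only from sets of B; a shared position is therefore a 1 in both
  rows.\<close>

lemma slot_meet:
  assumes "k < u" "k' < u" "r < n"
  shows "slot n u X r k = slot n u X (n + j) k' \<longleftrightarrow> k = k' \<and> k \<in> X r \<and> k \<in> X (n + j)"
  using assms by (auto simp: slot_def)

definition meets :: "nat \<Rightarrow> nat \<Rightarrow> (nat \<Rightarrow> nat set) \<Rightarrow> nat \<Rightarrow> nat \<Rightarrow> bool" where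
  "meets n u X i j \<longleftrightarrow> (\<exists>k<u. k \<in> X i \<and> k \<in> X (n + j))"

text \<open>Turns a distance below 3 into a common neighbour, which the neighbourhood lemmas can
  identify or exclude.\<close>

lemma walk2:
  assumes "walk V E p" "length p \<le> 3" "hd p = x" "last p = y" "x \<noteq> y" "{x, y} \<notin> E"
  shows "\<exists>z. {x, z} \<in> E \<and> {z, y} \<in> E"
proof -
  obtain a q where p: "p = a # q" using assms by (cases p) (auto simp: walk_def)
  then obtain c q' where q: "q = c # q'" using assms by (cases q) auto
  then obtain d q'' where "q' = d # q''" using assms p by (cases q') (auto simp: walk_def)
  moreover from this have "q'' = []" using assms p q by simp
  ultimately show ?thesis using assms p q by (auto simp: walk_def)
qed

text \<open>A common element gives a path of length 2. Conversely, a common neighbour is neither the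
  root, which is adjacent to no set of B, nor \<open>6 + 2 * n + 3 * u\<close>, which is adjacent to
  no set of A; so it is a common \<open>slot\<close>.\<close>

lemma hs_dist_AB:
  assumes "i < n" "j < n"
  shows "gdist {..<9 + 2 * n + 3 * u} (hs_E n u X) (6 + n + j) (6 + i) < 3 \<longleftrightarrow> meets n u X i j"
    (is "gdist ?V ?E ?b ?a < 3 \<longleftrightarrow> _")
proof
  assume "meets n u X i j"
  then obtain k where k: "k < u" "k \<in> X i" "k \<in> X (n + j)" by (auto simp: meets_def)
  let ?x = "6 + 2 * n + k"
  have "slot n u X i k = k" "slot n u X (n + j) k = k" using k by (auto simp: slot_def)
  then have "(?a, ?x) \<in> set (hs_edges n u X)" "(?b, ?x) \<in> set (hs_edges n u X)"
    using bit_edge[of i n k u X] bit_edge[of "n + j" n k u X] k assms by (simp_all add: add.assoc)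
  then have "walk ?V ?E [?b, ?x, ?a]" using k assms by (simp add: walk_def hs_E_iff)
  then have "gdist ?V ?E ?b ?a \<le> 2" by (rule gdist_le) auto
  then show "gdist ?V ?E ?b ?a < 3" by simp
next
  assume less: "gdist ?V ?E ?b ?a < 3"
  obtain p where p: "walk ?V ?E p" "hd p = ?b" "last p = ?a" "length p = Suc (gdist ?V ?E ?b ?a)"
    using gdist_walk[OF hs.connected, of ?b n u ?a X] assms by auto
  have ba: "{?b, ?a} \<notin> ?E" using hs_nbr_B[of n j ?a u X] assms by auto
  obtain z where z: "{?b, z} \<in> ?E" "{z, ?a} \<in> ?E"
    using walk2[OF p(1) _ p(2,3) _ ba] p(4) less assms by auto
  from hs_nbr_A[of i z n u X] z(2) assms
  have A: "z = 8 + 2 * n + 3 * u \<or> (\<exists>k<u. z = 6 + 2 * n + slot n u X i k)"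
    by (simp add: insert_commute)
  from hs_nbr_B[OF z(1)] assms
  have B: "z = 6 + 2 * n + 3 * u \<or> (\<exists>k<u. z = 6 + 2 * n + slot n u X (n + j) k)" by simp
  obtain k where k: "k < u" "z = 6 + 2 * n + slot n u X i k"
    using A B slot_le[of _ u n X "n + j"] by fastforce
  then obtain k' where k': "k' < u" "z = 6 + 2 * n + slot n u X (n + j) k'"
    using B slot_le[of k u n X i] by auto
  show "meets n u X i j"
    using k k' slot_meet[of k u k' i n X j] assms unfolding meets_def by auto
qed

lemma hs_dist_B0:
  assumes "j < n"
  shows "3 \<le> gdist {..<9 + 2 * n + 3 * u} (hs_E n u X) (6 + n + j) 0"
    (is "3 \<le> gdist ?V ?E ?b 0")
proof (rule ccontr)
  assume less: "\<not> 3 \<le> gdist ?V ?E ?b 0"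
  obtain p where p: "walk ?V ?E p" "hd p = ?b" "last p = 0" "length p = Suc (gdist ?V ?E ?b 0)"
    using gdist_walk[OF hs.connected, of ?b n u 0 X] assms by auto
  have ba: "{?b, 0} \<notin> ?E" using hs_nbr_B[of n j 0 u X] assms by auto
  obtain z where z: "{?b, z} \<in> ?E" "{z, 0} \<in> ?E"
    using walk2[OF p(1) _ p(2,3) _ ba] p(4) less assms by auto
  from hs_nbr_B[OF z(1)] assms hs_nbr_0[OF z(2)] show False
    using slot_le[of _ u n X "n + j"] by fastforce
qed

lemma gdist_pos:
  assumes "connected_graph V E" "u \<in> V" "v \<in> V" "u \<noteq> v"
  shows "0 < gdist V E u v"
proof (rule ccontr)
  assume "\<not> 0 < gdist V E u v"
  then obtain p where "hd p = u" "last p = v" "length p = Suc 0"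
    using gdist_walk[OF assms(1-3)] by auto
  then show False using assms(4) by (auto simp: length_Suc_conv)
qed

section \<open>The cost that each vertex takes over\<close>

lemma gdist_self: "v \<in> V \<Longrightarrow> gdist V E v v = 0"
  using gdist_le[OF walk_singleton, of v V v v 0 E] by simp

text \<open>Only vertex 0, the sets and the root carry cost. The root has level 0 and cannot be
  taken; vertex 0 and the sets of A have level 1 and are taken only by themselves; the sets of B
  have level 3.\<close>

lemma hs_stolen_eq:
  assumes v: "v < 8 + 2 * n + 3 * u"
  shows "hs.stolen n u X (hs_cost n u) v =
    (if v = 0 then real (2 * n + 1) else if 6 \<le> v \<and> v < 6 + n then 2 else 0) +
    2 * real (card {j. j < n \<and> gdist {..<9 + 2 * n + 3 * u} (hs_E n u X) (6 + n + j) v < 3})"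
    (is "_ = _ + 2 * real (card ?J)")
proof -
  let ?V = "{..<9 + 2 * n + 3 * u}" and ?E = "hs_E n u X"
  let ?T = "{x \<in> ?V. gdist ?V ?E x v < hs_lev n u x}"
  let ?B = "(\<lambda>j. 6 + n + j) ` ?J"
  let ?A = "if v = 0 \<or> 6 \<le> v \<and> v < 6 + n then {v} else {}"
  have sub: "?A \<union> ?B \<subseteq> ?T"
    using v by (auto simp: hs_lev_def gdist_self)
  have zero: "hs_cost n u x = 0" if x: "x \<in> ?T - (?A \<union> ?B)" for x
  proof (rule ccontr)
    assume nz: "hs_cost n u x \<noteq> 0"
    have less: "gdist ?V ?E x v < hs_lev n u x" "x < 9 + 2 * n + 3 * u" using x by auto
    from nz less consider "x = 0" | "6 \<le> x" "x < 6 + n" | "6 + n \<le> x" "x < 6 + 2 * n"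
      | "x = 8 + 2 * n + 3 * u"
      unfolding hs_cost_def by (auto split: if_splits; linarith)
    then show False
    proof cases
      case 1
      then have "gdist ?V ?E x v = 0" using less by (simp add: hs_lev_def)
      then have "x = v" using gdist_pos[OF hs.connected, of x n u v X] v 1 by auto
      then show False using x 1 by auto
    next
      case 2
      then have "gdist ?V ?E x v = 0" using less by (simp add: hs_lev_def)
      then have "x = v" using gdist_pos[OF hs.connected, of x n u v X] v 2 by auto
      then show False using x 2 by auto
    next
      case 3
      then obtain j where j: "x = 6 + n + j" "j < n" using le_Suc_ex by fastforce
      then have "j \<in> ?J" using less by (simp add: hs_lev_def)
      then show False using x j by auto
    next
      case 4
      then show False using less by (simp add: hs_lev_def)
    qed
  qed
  have "hs.stolen n u X (hs_cost n u) v = sum (hs_cost n u) (?A \<union> ?B)"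
    unfolding hs.stolen_def by (rule sum.mono_neutral_right) (use sub zero in auto)
  also have "\<dots> = sum (hs_cost n u) ?A + sum (hs_cost n u) ?B"
    by (rule sum.union_disjoint) auto
  also have "sum (hs_cost n u) ?A = (if v = 0 then real (2 * n + 1) else if 6 \<le> v \<and> v < 6 + n then 2 else 0)"
    by (auto simp: hs_cost_def)
  also have "sum (hs_cost n u) ?B = (\<Sum>j\<in>?J. 2)"
    by (subst sum.reindex) (auto simp: inj_on_def hs_cost_def intro!: sum.cong)
  finally show ?thesis by simp
qed

lemma hs_stolen_0: "hs.stolen n u X (hs_cost n u) 0 = real (2 * n + 1)"
proof -
  have "{j. j < n \<and> gdist {..<9 + 2 * n + 3 * u} (hs_E n u X) (6 + n + j) 0 < 3} = {}"
    using hs_dist_B0[of _ n u X] by fastforce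
  then show ?thesis by (simp add: hs_stolen_eq)
qed

lemma hs_stolen_le:
  assumes "0 < v" "v < 8 + 2 * n + 3 * u" "\<not> (6 \<le> v \<and> v < 6 + n)"
  shows "hs.stolen n u X (hs_cost n u) v \<le> real (2 * n)"
proof -
  have "card {j. j < n \<and> gdist {..<9 + 2 * n + 3 * u} (hs_E n u X) (6 + n + j) v < 3} \<le> card {..<n}"
    by (rule card_mono) auto
  then show ?thesis using assms by (auto simp: hs_stolen_eq)
qed

lemma hs_stolen_A:
  assumes "i < n"
  shows "hs.stolen n u X (hs_cost n u) (6 + i) = 2 + 2 * real (card {j. j < n \<and> meets n u X i j})"
proof -
  have "{j. j < n \<and> gdist {..<9 + 2 * n + 3 * u} (hs_E n u X) (6 + n + j) (6 + i) < 3} =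
      {j. j < n \<and> meets n u X i j}"
    using hs_dist_AB[OF assms] by auto
  then show ?thesis using assms by (simp add: hs_stolen_eq)
qed

lemma hs_stolen_bound:
  assumes "v < 8 + 2 * n + 3 * u"
  shows "hs.stolen n u X (hs_cost n u) v \<le> real (2 * n + 2)"
proof -
  consider "v = 0" | i where "v = 6 + i" "i < n" | "0 < v" "\<not> (6 \<le> v \<and> v < 6 + n)"
    by (metis add_less_cancel_left gr0I le_Suc_ex)
  then show ?thesis
  proof cases
    case 2
    have "card {j. j < n \<and> meets n u X i j} \<le> card {..<n}" by (rule card_mono) auto
    then show ?thesis using 2 by (simp add: hs_stolen_A)
  qed (use hs_stolen_0[of n u X] hs_stolen_le[of v n u X] assms in auto)
qed

lemma hs_total: "sum (hs_cost n u) {..<9 + 2 * n + 3 * u} \<ge> 2 * real (2 * n + 2)" if "n \<ge> 1"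
proof -
  \<comment> \<open>The left side is \<open>4 * n + 4\<close>, and the three costs give
    \<open>4 * n + 5\<close>. Vertex 6 is a set because \<open>n \<ge> 1\<close>.\<close>
  have "2 * real (2 * n + 2) \<le> sum (hs_cost n u) {0, 6, 8 + 2 * n + 3 * u}"
    using that by (simp add: hs_cost_def)
  also have "\<dots> \<le> sum (hs_cost n u) {..<9 + 2 * n + 3 * u}"
    by (rule sum_mono2) (auto simp: hs_cost_def)
  finally show ?thesis .
qed

lemma hs_balanced_vertex_0_iff:
  assumes n: "n \<ge> 1"
    and bal: "balanced_vertex {..<9 + 2 * n + 3 * u} (hs_E n u X) (hs_cost n u) [8 + 2 * n + 3 * u] v"
  shows "v = 0 \<longleftrightarrow> \<not> (\<exists>i<n. \<forall>j<n. meets n u X i j)"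
proof -
  let ?st = "hs.stolen n u X (hs_cost n u)"
  have "2 * ?st w \<le> sum (hs_cost n u) {..<9 + 2 * n + 3 * u}"
    if "w \<in> {..<9 + 2 * n + 3 * u} - {8 + 2 * n + 3 * u}" for w
    using hs_stolen_bound[of w n u X] hs_total[OF n, of u] that by auto
  from hs.balanced_vertex_iff[OF this, of v] bal
  have v: "v < 8 + 2 * n + 3 * u" and max: "\<And>w. w < 8 + 2 * n + 3 * u \<Longrightarrow> ?st w \<le> ?st v"
    by auto
  show ?thesis
  proof
    assume "v = 0"
    show "\<not> (\<exists>i<n. \<forall>j<n. meets n u X i j)"
    proof
      assume "\<exists>i<n. \<forall>j<n. meets n u X i j"
      then obtain i where i: "i < n" "\<forall>j<n. meets n u X i j" by blast
      then have "{j. j < n \<and> meets n u X i j} = {..<n}" by auto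
      then have "?st (6 + i) = real (2 * n + 2)" using hs_stolen_A[OF i(1), of u X] by simp
      then show False using max[of "6 + i"] i hs_stolen_0[of n u X] \<open>v = 0\<close> by simp
    qed
  next
    assume none: "\<not> (\<exists>i<n. \<forall>j<n. meets n u X i j)"
    show "v = 0"
    proof (rule ccontr)
      assume "v \<noteq> 0"
      have ge: "?st v \<ge> real (2 * n + 1)" using max[of 0] hs_stolen_0[of n u X] by simp
      then have "6 \<le> v \<and> v < 6 + n" using hs_stolen_le[of v n u X] v \<open>v \<noteq> 0\<close> by force
      then obtain i where i: "v = 6 + i" "i < n" by (metis add_less_cancel_left le_Suc_ex)
      then obtain j where "j < n" "\<not> meets n u X i j" using none by blast
      \<comment> \<open>One missed set lowers \<open>2 * n + 2\<close> to at most
        \<open>2 * n\<close>, which is below the value at vertex 0.\<close>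
      then have "{j. j < n \<and> meets n u X i j} \<subset> {..<n}" by auto
      then have "card {j. j < n \<and> meets n u X i j} < card {..<n}" by (rule psubset_card_mono[rotated]) auto
      then show False using ge i hs_stolen_A[OF i(2), of u X] by simp
    qed
  qed
qed

lemma hs_to_bv_valid:
  "valid_bv_instance (hs_to_bv n u X)"
proof -
  have E: "bv_E (hs_to_bv n u X) = hs_E n u X" by (simp add: bv_E_def hs_E_def hs_to_bv_def)
  have V: "bv_V (hs_to_bv n u X) = {..<9 + 2 * n + 3 * u}" by (simp add: bv_V_def hs_to_bv_def)
  have "simple_graph {..<9 + 2 * n + 3 * u} (hs_E n u X)"
    using hs_edges_ordered[of _ _ n u X] unfolding simple_graph_def hs_E_def
    by (fastforce simp: card_insert_if)
  moreover have "{..<9 + 2 * n + 3 * u} - {8 + 2 * n + 3 * u} \<noteq> {}"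
  proof -
    have "0 \<in> {..<9 + 2 * n + 3 * u} - {8 + 2 * n + 3 * u}" by simp
    then show ?thesis by blast
  qed
  ultimately show ?thesis
    unfolding valid_bv_instance_def E V
    using hs.connected[of n u X] distinct_hs_E[of n u X]
    by (simp add: hs_to_bv_def hs_cost_def proper_vertex_list_def del: Diff_eq_empty_iff)
qed

section \<open>Writing the graph into memory\<close>

definition flat :: "(nat \<times> nat) list \<Rightarrow> nat list" where
  "flat es = concat (map (\<lambda>(x, y). [x, y]) es)"

lemma flat_simps [simp]: "flat [] = []" "flat (e # es) = fst e # snd e # flat es"
  "flat (es @ es') = flat es @ flat es'"
  by (auto simp: flat_def split: prod.splits)

lemma length_flat [simp]: "length (flat es) = 2 * length es"
  by (induction es) auto

text \<open>Word cells 0 to 12 serve as registers; the edges written so far follow.\<close>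

definition heap :: "(nat \<Rightarrow> nat) \<Rightarrow> (nat \<times> nat) list \<Rightarrow> (nat \<Rightarrow> nat) \<Rightarrow> bool" where
  "heap h es w \<longleftrightarrow> (\<forall>a\<ge>13. w a = (if a < 13 + 2 * length es then flat es ! (a - 13) else h a))"

lemma heap_low: "i < 13 \<Longrightarrow> heap h es (w(i := v)) \<longleftrightarrow> heap h es w"
  by (auto simp: heap_def)

lemma heap_emit:
  assumes "heap h es w" "\<And>a. 13 \<le> a \<Longrightarrow>
     w' a = (if a = 13 + 2 * length es then x else if a = 14 + 2 * length es then y else w a)"
  shows "heap h (es @ [(x, y)]) w'"
  unfolding heap_def
proof (intro allI impI)
  fix a :: nat assume a: "13 \<le> a"
  consider "a < 13 + 2 * length es" | "a = 13 + 2 * length es" | "a = 14 + 2 * length es"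
    | "15 + 2 * length es \<le> a" by linarith
  then show "w' a = (if a < 13 + 2 * length (es @ [(x, y)]) then flat (es @ [(x, y)]) ! (a - 13) else h a)"
    using assms(1) assms(2)[OF a] a unfolding heap_def by cases (auto simp: nth_append)
qed

abbreviation emit :: "nat \<Rightarrow> nat \<Rightarrow> instr list" where
  "emit i j \<equiv> [WStore 3 i, WOp WAdd 3 3 4, WStore 3 j, WOp WAdd 3 3 4]"

section \<open>The commands of the preparation\<close>

text \<open>
  The input bits move to the real memory, since low word cells are needed as registers.
  Real cells 0 and 1 are free for other uses because the bits occupy word cells from 2 on.
\<close>

definition save_low :: com where
  "save_low = Blk ([ROfWord 2 2, ROfWord 3 3, ROfWord 4 4, ROfWord 5 5, ROfWord 6 6, ROfWord 7 7,
     ROfWord 8 8, ROfWord 9 9, ROfWord 10 10, ROfWord 11 11, ROfWord 12 12] @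
     [Const 4 1, WOp WMul 8 0 1, WOp WAdd 5 8 8, Const 6 2, WOp WAdd 5 5 6, Const 2 13])"

text \<open>An edge takes two words and the bit it replaces only one, so writing edges would
  overtake reading bits. Hence the bits beyond the registers are moved as well.\<close>

definition save_high :: com where
  "save_high = While (WLess 2 5) (Blk [WLoad 6 2, ROfWord 0 6, RStore 2 0, WOp WAdd 2 2 4])"

definition bits_init :: com where
  "bits_init = Blk [WOp WAdd 5 8 8, Const 3 13, Const 9 6, WOp WAdd 10 0 0, WOp WAdd 10 10 9, Const 2 0]"

text \<open>Register 11 receives the shift that \<open>slot\<close> gives to a zero bit:
  \<open>u\<close> for A and \<open>2 * u\<close> for B, because \<open>t div (n * u)\<close> is 0
  or 1. \<open>RStore 6 1\<close> clears the bit just read, since costs will replace it.\<close>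

definition bit_read :: com where
  "bit_read = Blk [Const 6 2, WOp WAdd 6 2 6, RLoad 0 6, RStore 6 1,
     WOp WDiv 6 2 1, WOp WAdd 6 6 9, WOp WMod 7 2 1, WOp WAdd 7 7 10,
     WOp WDiv 11 2 8, WOp WMul 11 11 1, WOp WAdd 11 11 1]"

text \<open>A conditional; the body falsifies the condition.\<close>

definition bit_test :: com where
  "bit_test = While (RLess 1 0) (Blk [Const 11 0, ROfWord 0 11])"

definition bit_write :: com where
  "bit_write = Blk (WOp WAdd 7 7 11 # emit 6 7 @ [WOp WAdd 2 2 4])"

definition rows_init :: com where
  "rows_init = Blk [Const 12 3, WOp WMul 12 12 1, WOp WAdd 12 12 10, WOp WAdd 12 12 4,
     WOp WAdd 12 12 4, Const 2 2, ROfWord 0 2, WOp WAdd 5 0 0, Const 2 0]"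

definition rows_body :: com where
  "rows_body = Blk ([WOp WAdd 6 9 2, WOp WDiv 7 2 0, WOp WAdd 7 7 7, WOp WSub 7 12 7] @ emit 6 7 @
     [RStore 6 0, WOp WAdd 2 2 4])"

definition hub_init :: com where
  "hub_init = Blk [Const 5 3, WOp WMul 5 5 1, WOp WAdd 5 5 4, WOp WSub 7 12 4, Const 2 0]"

definition hub_body :: com where
  "hub_body = Blk (WOp WAdd 6 10 2 # emit 6 7 @ [WOp WAdd 2 2 4])"

definition hub_end :: com where
  "hub_end = Blk (Const 2 0 # emit 2 12 @ emit 7 12)"

text \<open>The edge count comes from the write pointer: edges of the output start at cell 3, so it
  is the pointer minus 3, halved. Real cells 0 and 1 end as the costs of vertices 0 and 1, and
  registers 3 to 12 as the five leaf edges.\<close>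

definition finish :: com where
  "finish = Blk (
     [WStore 3 12, WOp WAdd 6 0 0, WOp WAdd 6 6 4, ROfWord 0 6, WOp WAdd 6 6 4, ROfWord 1 6,
      RStore 12 1, ROfWord 1 2, Const 6 3, WOp WSub 1 3 6, Const 6 2, WOp WDiv 1 1 6, WOp WAdd 0 12 4] @
     [Const 2 1, Const 3 0, Const 4 1, Const 5 0, Const 6 2, Const 7 0, Const 8 3, Const 9 0,
      Const 10 4, Const 11 0, Const 12 5])"

definition prep :: com where
  "prep = save_low ;; save_high ;; bits_init ;;
     While (WLess 2 5) (bit_read ;; bit_test ;; bit_write) ;;
     rows_init ;; While (WLess 2 5) rows_body ;; hub_init ;; While (WLess 2 5) hub_body ;;
     hub_end ;; finish"

text \<open>Here \<open>h\<close> is the initial word memory, with the bits from cell 2 on. The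
  bound on \<open>b\<close> has the size of the write pointer, which ends at
  \<open>19 + 4 * (n * u) + 4 * n + 6 * u\<close>.\<close>

context
  fixes n u b :: nat and X :: "nat \<Rightarrow> nat set" and h :: "nat \<Rightarrow> nat"
  assumes n: "n \<ge> 1" and h0: "h 0 = n" and h1: "h 1 = u"
    and hbit: "\<And>t. t < 2 * n * u \<Longrightarrow> h (t + 2) = (if t mod u \<in> X (t div u) then 1 else 0)"
    and hzero: "\<And>a. a \<ge> 2 + 2 * n * u \<Longrightarrow> h a = 0"
    and b: "4 * (n * u) + 4 * n + 6 * u + 40 \<le> b"
begin

definition low_saved where
  "low_saved j w r \<longleftrightarrow> w 0 = n \<and> w 1 = u \<and> w 2 = 13 + j \<and> w 4 = 1 \<and> w 5 = 2 * (n * u) + 2 \<and> w 8 = n * u \<and>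
     (\<forall>a\<ge>13. w a = h a) \<and> r 1 = (0::real) \<and> (\<forall>p\<ge>2. r p = (if p < 13 + j then real (h p) else 0))"

lemma save_low_ok: "triple b (\<lambda>w r. w = h \<and> r = (\<lambda>_. 0)) save_low 17 (low_saved 0)"
proof -
  have low: "p = 2 \<or> p = 3 \<or> p = 4 \<or> p = 5 \<or> p = 6 \<or> p = 7 \<or> p = 8 \<or> p = 9 \<or> p = 10 \<or> p = 11 \<or> p = 12"
    if "2 \<le> p" "p < 13" for p :: nat using that by presburger
  show ?thesis
    unfolding save_low_def
    by (rule triple_conseq[OF triple_blk[where P = "\<lambda>w r. w = h \<and> r = (\<lambda>_. 0)" and R = "low_saved 0"]])
      (use b in \<open>auto simp: low_saved_def h0 h1[unfolded One_nat_def] dest: low\<close>)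
qed

definition input_saved where
  "input_saved w r \<longleftrightarrow> w 0 = n \<and> w 1 = u \<and> w 4 = 1 \<and> w 8 = n * u \<and>
     (\<forall>a\<ge>13. w a = h a) \<and> r 1 = (0::real) \<and> (\<forall>p\<ge>2. r p = real (h p))"

lemma save_high_ok: "triple b (low_saved 0) save_high (12 * (n * u) + 14) input_saved"
proof -
  \<comment> \<open>Truncated subtraction: there is no round if all bits lie in the cells 2 to
    12.\<close>
  let ?m = "2 * (n * u) + 2 - 13"
  have "triple b (low_saved 0) save_high (?m * (4 + 2) + 2) (low_saved ?m)"
    unfolding save_high_def
  proof (rule triple_while)
    fix k assume k: "k < ?m"
    show "triple b (low_saved k) (Blk [WLoad 6 2, ROfWord 0 6, RStore 2 0, WOp WAdd 2 2 4]) 4 (low_saved (Suc k))"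
      by (rule triple_conseq[OF triple_blk[where P = "low_saved k" and R = "low_saved (Suc k)"]])
        (use b k in \<open>auto simp: low_saved_def less_Suc_eq\<close>)
  qed (auto simp: low_saved_def)
  moreover have "input_saved w r" if P: "low_saved ?m w r" for w r
  proof -
    have "r p = real (h p)" if "p \<ge> 2" for p
      using P that hzero[of p] by (cases "p < 13 + ?m") (auto simp: low_saved_def)
    then show ?thesis using P by (simp add: low_saved_def input_saved_def)
  qed
  ultimately show ?thesis by (auto intro: triple_conseq)
qed

abbreviation "bit_edges k \<equiv> map (\<lambda>t. (6 + t div u, 6 + 2 * n + slot n u X (t div u) (t mod u))) [0..<k]"

definition bits_written where
  "bits_written k w r \<longleftrightarrow> w 0 = n \<and> w 1 = u \<and> w 2 = k \<and> w 3 = 13 + 2 * k \<and> w 4 = 1 \<and> w 5 = 2 * (n * u) \<and>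
     w 8 = n * u \<and> w 9 = 6 \<and> w 10 = 6 + 2 * n \<and> heap h (bit_edges k) w \<and>
     r 1 = (0::real) \<and> (\<forall>p\<ge>2. r p = (if p < k + 2 then 0 else real (h p)))"

lemma bits_init_ok: "triple b input_saved bits_init 6 (bits_written 0)"
  unfolding bits_init_def
  by (rule triple_conseq[OF triple_blk[where P = input_saved and R = "bits_written 0"]])
    (use b in \<open>auto simp: input_saved_def bits_written_def heap_def\<close>)

text \<open>The index \<open>j\<close> counts rounds of \<open>bit_test\<close>. The bit itself is
  the number of rounds, so both outcomes end in \<open>bit_loaded k (h (k + 2))\<close>, with the
  shift surviving in register 11 only for a zero bit.\<close>

definition bit_loaded where
  "bit_loaded k j w r \<longleftrightarrow> w 0 = n \<and> w 1 = u \<and> w 2 = k \<and> w 3 = 13 + 2 * k \<and> w 4 = 1 \<and> w 5 = 2 * (n * u) \<and>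
     w 8 = n * u \<and> w 9 = 6 \<and> w 10 = 6 + 2 * n \<and> heap h (bit_edges k) w \<and>
     r 1 = (0::real) \<and> (\<forall>p\<ge>2. r p = (if p < Suc k + 2 then 0 else real (h p))) \<and>
     w 6 = 6 + k div u \<and> w 7 = 6 + 2 * n + k mod u \<and>
     w 11 = (if j = (0::nat) then (k div (n * u)) * u + u else (0::nat)) \<and>
     r 0 = (if j = 0 then real (h (k + 2)) else 0)"

lemma bit_index:
  assumes "k < 2 * (n * u)"
  shows "u > 0" "k mod u < u" "k div u < 2 * n" "k div (n * u) = (if k div u < n then 0 else 1)"
proof -
  show u: "u > 0" using assms by (auto intro!: gr0I)
  then show "k mod u < u" by simp
  show d: "k div u < 2 * n" using assms u by (simp add: div_less_iff_less_mult mult.assoc)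
  have "k div (n * u) = k div u div n" by (metis div_mult2_eq mult.commute)
  also have "\<dots> = (if k div u < n then 0 else 1)"
    using d n by (auto intro: div_nat_eqI)
  finally show "k div (n * u) = (if k div u < n then 0 else 1)" .
qed

lemma bit_read_ok:
  assumes k: "k < 2 * (n * u)"
  shows "triple b (bits_written k) bit_read 11 (bit_loaded k 0)"
  unfolding bit_read_def
  by (rule triple_conseq[OF triple_blk[where P = "bits_written k" and R = "bit_loaded k 0"]])
    (use b k bit_index[OF k] in \<open>auto simp: bits_written_def bit_loaded_def heap_low\<close>)

lemma bit_test_ok:
  assumes k: "k < 2 * (n * u)"
  shows "triple b (bit_loaded k 0) bit_test 6 (bit_loaded k (h (k + 2)))"
proof -
  have h: "h (k + 2) = 0 \<or> h (k + 2) = 1" using hbit[of k] k by (simp add: mult.assoc)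
  have "triple b (bit_loaded k 0) bit_test (h (k + 2) * (2 + 2) + 2) (bit_loaded k (h (k + 2)))"
    unfolding bit_test_def
  proof (rule triple_while[where I = "bit_loaded k"])
    fix j assume "j < h (k + 2)"
    then have j: "j = 0" using h by auto
    show "triple b (bit_loaded k j) (Blk [Const 11 0, ROfWord 0 11]) 2 (bit_loaded k (Suc j))"
      by (rule triple_conseq[OF triple_blk[where P = "bit_loaded k j" and R = "bit_loaded k (Suc j)"]])
        (use j in \<open>auto simp: bit_loaded_def heap_low\<close>)
  qed (use h in \<open>auto simp: bit_loaded_def\<close>)
  then show ?thesis by (rule triple_conseq) (use h in auto)
qed

lemma bit_write_ok:
  assumes k: "k < 2 * (n * u)"
  shows "triple b (bit_loaded k (h (k + 2))) bit_write 6 (bits_written (Suc k))"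
proof -
  note i = bit_index[OF k]
  have off: "k mod u + (if h (k + 2) = 0 then (k div (n * u)) * u + u else 0) =
      slot n u X (k div u) (k mod u)"
    using i hbit[of k] k by (simp add: slot_def mult.assoc)
  have "wp b (WOp WAdd 7 7 11 # emit 6 7 @ [WOp WAdd 2 2 4]) (bits_written (Suc k)) w r"
    if P: "bit_loaded k (h (k + 2)) w r" for w r
  proof -
    let ?y = "6 + 2 * n + slot n u X (k div u) (k mod u)"
    have y: "w 7 + w 11 = ?y" using P off by (simp add: bit_loaded_def)
    have "?y \<le> b" using slot_le[OF i(2), of n X "k div u"] b by linarith
    moreover have "w 0 = n" "w 1 = u" "w 2 = k" "w 3 = 13 + 2 * k" "w 4 = 1" "w 5 = 2 * (n * u)"
      "w 8 = n * u" "w 9 = 6" "w 10 = 6 + 2 * n" "w 6 = 6 + k div u" "heap h (bit_edges k) w" "r 1 = 0"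
      "\<forall>p\<ge>2. r p = (if p < Suc k + 2 then 0 else real (h p))"
      using P by (simp_all add: bit_loaded_def)
    ultimately show ?thesis using y b k
      by (simp add: bits_written_def heap_low) (rule heap_emit[of h "bit_edges k" w]; simp)
  qed
  then show ?thesis unfolding bit_write_def
    by (intro triple_conseq[OF triple_blk[where P = "bit_loaded k (h (k + 2))" and R = "bits_written (Suc k)"]]) auto
qed

lemma bits_loop_ok:
  "triple b (bits_written 0) (While (WLess 2 5) (bit_read ;; bit_test ;; bit_write)) (50 * (n * u) + 2) (bits_written (2 * (n * u)))"
proof -
  have "triple b (bits_written 0) (While (WLess 2 5) (bit_read ;; bit_test ;; bit_write))
     (2 * (n * u) * (11 + (6 + 6) + 2) + 2) (bits_written (2 * (n * u)))"
  proof (rule triple_while)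
    fix k assume k: "k < 2 * (n * u)"
    show "triple b (bits_written k) (bit_read ;; bit_test ;; bit_write) (11 + (6 + 6)) (bits_written (Suc k))"
      by (rule triple_seq[OF bit_read_ok[OF k] triple_seq[OF bit_test_ok[OF k] bit_write_ok[OF k]]])
  qed (auto simp: bits_written_def)
  then show ?thesis by (rule triple_conseq) auto
qed

abbreviation "row_edges i \<equiv> bit_edges (2 * (n * u)) @
  map (\<lambda>r. (6 + r, if r < n then 8 + 2 * n + 3 * u else 6 + 2 * n + 3 * u)) [0..<i]"

definition rows_written where
  "rows_written i w r \<longleftrightarrow> w 0 = n \<and> w 1 = u \<and> w 2 = i \<and> w 3 = 13 + 4 * (n * u) + 2 * i \<and> w 4 = 1 \<and> w 5 = 2 * n \<and>
     w 9 = 6 \<and> w 10 = 6 + 2 * n \<and> w 12 = 8 + 2 * n + 3 * u \<and> heap (\<lambda>_. 0) (row_edges i) w \<and>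
     r 0 = 2 \<and> r 1 = (0::real) \<and> (\<forall>p\<ge>2. r p = (if 6 \<le> p \<and> p < 6 + i then 2 else 0))"

lemma rows_init_ok: "triple b (bits_written (2 * (n * u))) rows_init 9 (rows_written 0)"
proof -
  \<comment> \<open>The edges now fill \<open>4 * (n * u)\<close> cells from 13 on, which covers the
    rest of the input; beyond them \<open>h\<close> is 0.\<close>
  have "heap (\<lambda>_. 0) (bit_edges (2 * (n * u))) w" if "heap h (bit_edges (2 * (n * u))) w" for w
    using that hzero by (auto simp: heap_def mult.assoc)
  then show ?thesis unfolding rows_init_def
    by (intro triple_conseq[OF triple_blk[where P = "bits_written (2 * (n * u))" and R = "rows_written 0"]])
      (use b hzero in \<open>auto simp: bits_written_def rows_written_def heap_low\<close>)
qed

lemma rows_body_ok: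
  assumes i: "i < 2 * n"
  shows "triple b (rows_written i) rows_body 10 (rows_written (Suc i))"
proof -
  have d: "i div n = (if i < n then 0 else 1)"
    using i n by (auto intro: div_nat_eqI)
  have "wp b ([WOp WAdd 6 9 2, WOp WDiv 7 2 0, WOp WAdd 7 7 7, WOp WSub 7 12 7] @ emit 6 7 @
     [RStore 6 0, WOp WAdd 2 2 4]) (rows_written (Suc i)) w r" if P: "rows_written i w r" for w r
  proof (cases "i < n")
    case True
    then show ?thesis using P b d unfolding rows_written_def
      by (simp add: heap_low) (rule heap_emit[of _ "row_edges i" w, unfolded append_assoc]; simp)
  next
    case False
    then show ?thesis using P b i d unfolding rows_written_def
      by (simp add: heap_low) (rule heap_emit[of _ "row_edges i" w, unfolded append_assoc]; simp)
  qed
  then show ?thesis unfolding rows_body_def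
    by (intro triple_conseq[OF triple_blk[where P = "rows_written i" and R = "rows_written (Suc i)"]]) auto
qed

lemma rows_loop_ok:
  "triple b (rows_written 0) (While (WLess 2 5) rows_body) (24 * n + 2) (rows_written (2 * n))"
proof -
  have "triple b (rows_written 0) (While (WLess 2 5) rows_body) (2 * n * (10 + 2) + 2) (rows_written (2 * n))"
    proof (rule triple_while)
    show "triple b (rows_written k) rows_body 10 (rows_written (Suc k))" if "k < 2 * n" for k
      by (rule rows_body_ok[OF that])
  qed (auto simp: rows_written_def)
  then show ?thesis by (rule triple_conseq) auto
qed

abbreviation "hub_edges k \<equiv> row_edges (2 * n) @ map (\<lambda>k. (6 + 2 * n + k, 7 + 2 * n + 3 * u)) [0..<k]"

definition hub_written where
  "hub_written k w r \<longleftrightarrow> w 0 = n \<and> w 1 = u \<and> w 2 = k \<and> w 3 = 13 + 4 * (n * u) + 4 * n + 2 * k \<and> w 4 = 1 \<and>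
     w 5 = 3 * u + 1 \<and> w 7 = 7 + 2 * n + 3 * u \<and>
     w 10 = 6 + 2 * n \<and> w 12 = 8 + 2 * n + 3 * u \<and> heap (\<lambda>_. 0) (hub_edges k) w \<and>
     r 0 = 2 \<and> r 1 = (0::real) \<and> (\<forall>p\<ge>2. r p = (if 6 \<le> p \<and> p < 6 + 2 * n then 2 else 0))"

lemma hub_init_ok: "triple b (rows_written (2 * n)) hub_init 5 (hub_written 0)"
  unfolding hub_init_def
  by (intro triple_conseq[OF triple_blk[where P = "rows_written (2 * n)" and R = "hub_written 0"]])
    (use b in \<open>auto simp: rows_written_def hub_written_def heap_low\<close>)

lemma hub_body_ok:
  assumes k: "k < 3 * u + 1"
  shows "triple b (hub_written k) hub_body 6 (hub_written (Suc k))"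
proof -
  have "wp b (WOp WAdd 6 10 2 # emit 6 7 @ [WOp WAdd 2 2 4]) (hub_written (Suc k)) w r" if "hub_written k w r" for w r
    using that b k unfolding hub_written_def
    by (simp add: heap_low) (rule heap_emit[of _ "hub_edges k" w, unfolded append_assoc]; simp)
  then show ?thesis unfolding hub_body_def
    by (intro triple_conseq[OF triple_blk[where P = "hub_written k" and R = "hub_written (Suc k)"]]) auto
qed

lemma hub_loop_ok:
  "triple b (hub_written 0) (While (WLess 2 5) hub_body) (24 * u + 10) (hub_written (3 * u + 1))"
proof -
  have "triple b (hub_written 0) (While (WLess 2 5) hub_body) ((3 * u + 1) * (6 + 2) + 2) (hub_written (3 * u + 1))"
  proof (rule triple_while)
    show "triple b (hub_written k) hub_body 6 (hub_written (Suc k))" if "k < 3 * u + 1" for k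
      by (rule hub_body_ok[OF that])
  qed (auto simp: hub_written_def)
  then show ?thesis by (rule triple_conseq) auto
qed

abbreviation "nonleaf_edges \<equiv> hub_edges (3 * u + 1) @
  [(0, 8 + 2 * n + 3 * u), (7 + 2 * n + 3 * u, 8 + 2 * n + 3 * u)]"

definition edges_written where
  "edges_written w r \<longleftrightarrow> w 0 = n \<and> w 1 = u \<and> w 2 = 0 \<and> w 3 = 19 + 4 * (n * u) + 4 * n + 6 * u \<and> w 4 = 1 \<and>
     w 12 = 8 + 2 * n + 3 * u \<and> heap (\<lambda>_. 0) nonleaf_edges w \<and>
     r 0 = 2 \<and> r 1 = (0::real) \<and> (\<forall>p\<ge>2. r p = (if 6 \<le> p \<and> p < 6 + 2 * n then 2 else 0))"

lemma hub_end_ok: "triple b (hub_written (3 * u + 1)) hub_end 9 edges_written"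
proof -
  let ?s = "8 + 2 * n + 3 * u" and ?q = "7 + 2 * n + 3 * u" and ?e = "15 + (4 * (n * u) + (4 * n + 6 * u))"
  have "wp b (Const 2 0 # emit 2 12 @ emit 7 12) edges_written w r" if P: "hub_written (3 * u + 1) w r" for w r
  proof -
    \<comment> \<open>The memory after the first of the two edges, since \<open>heap_emit\<close>
      adds one edge at a time.\<close>
    let ?w1 = "w(2 := 0, ?e := 0, 16 + (4 * (n * u) + (4 * n + 6 * u)) := ?s)"
    have "heap (\<lambda>_. 0) (hub_edges (3 * u + 1) @ [(0, ?s)]) ?w1"
      by (rule heap_emit[of _ _ w]) (use P in \<open>auto simp: hub_written_def\<close>)
    then have "heap (\<lambda>_. 0) ((hub_edges (3 * u + 1) @ [(0, ?s)]) @ [(?q, ?s)]) w'"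
      if "\<And>a. 13 \<le> a \<Longrightarrow> w' a = (if a = 2 + ?e then ?q else if a = 3 + ?e then ?s else ?w1 a)" for w'
      by (rule heap_emit) (use that in auto)
    then have "heap (\<lambda>_. 0) nonleaf_edges w'"
      if "\<And>a. 13 \<le> a \<Longrightarrow> w' a = (if a = 2 + ?e then ?q else if a = 3 + ?e then ?s else ?w1 a)" for w'
      using that by simp
    then show ?thesis using P b
      by (simp add: hub_written_def edges_written_def heap_low)
  qed
  then show ?thesis unfolding hub_end_def
    by (intro triple_conseq[OF triple_blk[where P = "hub_written (3 * u + 1)" and R = edges_written]]) auto
qed

definition prepared where
  "prepared w r \<longleftrightarrow> w 0 = 9 + 2 * n + 3 * u \<and> w 1 = 8 + 2 * (n * u) + 2 * n + 3 * u \<and> w 2 = 1 \<and> w 3 = 0 \<and> w 4 = 1 \<and>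
     w 5 = 0 \<and> w 6 = 2 \<and> w 7 = 0 \<and> w 8 = 3 \<and> w 9 = 0 \<and> w 10 = 4 \<and> w 11 = 0 \<and> w 12 = 5 \<and>
     (\<forall>a\<ge>13. w a = (if a < 13 + 2 * length nonleaf_edges then flat nonleaf_edges ! (a - 13)
        else if a = 13 + 2 * length nonleaf_edges then 8 + 2 * n + 3 * u else 0)) \<and>
     r 0 = real (2 * n + 1) \<and> r 1 = (0::real) \<and>
     (\<forall>p\<ge>2. r p = (if 6 \<le> p \<and> p < 6 + 2 * n then 2 else if p = 8 + 2 * n + 3 * u then real (2 * n + 2) else 0))"

lemma finish_ok: "triple b edges_written finish 24 prepared"
proof -
  have "wp b (
     [WStore 3 12, WOp WAdd 6 0 0, WOp WAdd 6 6 4, ROfWord 0 6, WOp WAdd 6 6 4, ROfWord 1 6,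
      RStore 12 1, ROfWord 1 2, Const 6 3, WOp WSub 1 3 6, Const 6 2, WOp WDiv 1 1 6, WOp WAdd 0 12 4] @
     [Const 2 1, Const 3 0, Const 4 1, Const 5 0, Const 6 2, Const 7 0, Const 8 3, Const 9 0,
      Const 10 4, Const 11 0, Const 12 5]) prepared w r" if P: "edges_written w r" for w r
  proof -
    define es where "es = nonleaf_edges"
    have "length es = 3 + 2 * (n * u) + 2 * n + 3 * u" by (simp add: es_def)
    moreover have "w 0 = n" "w 2 = 0" "w 3 = 19 + 4 * (n * u) + 4 * n + 6 * u" "w 4 = 1"
      "w 12 = 8 + 2 * n + 3 * u" "r 0 = 2" "r 1 = 0"
      "\<And>a. 13 \<le> a \<Longrightarrow> w a = (if a < 13 + 2 * length es then flat es ! (a - 13) else 0)"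
      "\<And>p. 2 \<le> p \<Longrightarrow> r p = (if 6 \<le> p \<and> p < 6 + 2 * n then 2 else 0)"
      using P by (simp_all add: edges_written_def heap_def es_def)
    ultimately show ?thesis using b unfolding prepared_def es_def[symmetric] by simp
  qed
  then show ?thesis unfolding finish_def
    by (intro triple_conseq[OF triple_blk[where P = edges_written and R = prepared]]) auto
qed

text \<open>The memories agree entirely, zeros beyond the input included; an arbitrary program may
  read any cell. The free \<open>rs\<close> and \<open>ws\<close> reflect that either memory depends
  on its own input only.\<close>

lemma prepared_init_state:
  assumes "prepared w r"
  shows "w = wmem (init_state (bv_words (hs_to_bv n u X)) rs)"
    and "r = rmem (init_state ws (map (bv_cost (hs_to_bv n u X)) [0..<bv_n (hs_to_bv n u X)]))"
proof -
  let ?L = "[9 + 2 * n + 3 * u, 8 + 2 * (n * u) + 2 * n + 3 * u, 1, 0, 1, 0, 2, 0, 3, 0, 4, 0, 5]"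
  have "hs_edges n u X = map (\<lambda>i. (0, Suc i)) [0..<5] @ nonleaf_edges"
    by (simp add: hs_edges_def mult.assoc del: upt_Suc)
  moreover have "flat (map (\<lambda>i. (0, Suc i)) [0..<5]) = [0, 1, 0, 2, 0, 3, 0, 4, 0, 5]"
    by (simp add: upt_rec)
  ultimately have words: "bv_words (hs_to_bv n u X) = ?L @ flat nonleaf_edges @ [8 + 2 * n + 3 * u]"
    using length_hs_edges[of n u X]
    by (simp add: bv_words_def hs_to_bv_def flat_def mult.assoc del: upt_Suc)
  show "w = wmem (init_state (bv_words (hs_to_bv n u X)) rs)"
  proof
    fix a
    show "w a = wmem (init_state (bv_words (hs_to_bv n u X)) rs) a"
    proof (cases "a < 13")
      case True
      then have "a \<in> {0, 1, 2, 3, 4, 5, 6, 7, 8, 9, 10, 11, 12}" by (simp; presburger)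
      then show ?thesis using assms unfolding prepared_def init_state_def words by auto
    next
      case False
      have "(if a < length (L @ F @ [z]) then (L @ F @ [z]) ! a else 0) =
          (if a < 13 + length F then F ! (a - 13) else if a = 13 + length F then z else 0)"
        if "length L = 13" for L F :: "nat list" and z
        using False that by (auto simp: nth_append)
      from this[of ?L "flat nonleaf_edges" "8 + 2 * n + 3 * u"] show ?thesis
        using assms False unfolding prepared_def init_state_def words by (simp only: length_flat) simp
    qed
  qed
  show "r = rmem (init_state ws (map (bv_cost (hs_to_bv n u X)) [0..<bv_n (hs_to_bv n u X)]))"
  proof
    fix p :: nat
    consider "p = 0" | "p = 1" | "2 \<le> p" by linarith
    then show "r p = rmem (init_state ws (map (bv_cost (hs_to_bv n u X)) [0..<bv_n (hs_to_bv n u X)])) p"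
      using assms by cases (auto simp: prepared_def init_state_def hs_to_bv_def hs_cost_def simp del: upt_Suc)
  qed
qed

lemma prep_ok:
  "triple b (\<lambda>w r. w = h \<and> r = (\<lambda>_. 0)) prep (62 * (n * u) + 24 * n + 24 * u + 100) prepared"
  unfolding prep_def
  by (rule triple_conseq[OF triple_seq[OF save_low_ok triple_seq[OF save_high_ok
     triple_seq[OF bits_init_ok triple_seq[OF bits_loop_ok triple_seq[OF rows_init_ok
     triple_seq[OF rows_loop_ok triple_seq[OF hub_init_ok triple_seq[OF hub_loop_ok
     triple_seq[OF hub_end_ok finish_ok]]]]]]]]]]) simp_all

end

section \<open>The reduction\<close>

lemma nth_concat_rows:
  "t < length Xs * u \<Longrightarrow> concat (map (\<lambda>X. map (f X) [0..<u]) Xs) ! t = f (Xs ! (t div u)) (t mod u)"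
proof (induction Xs arbitrary: t)
  case (Cons X Xs)
  then have u: "u > 0" by (auto intro!: gr0I)
  show ?case
  proof (cases "t < u")
    case False
    then have "t div u = Suc ((t - u) div u)" "t mod u = (t - u) mod u"
      using u by (simp_all add: le_div_geq le_mod_geq)
    then show ?thesis using Cons.IH[of "t - u"] Cons.prems False by (simp add: nth_append)
  qed (simp add: nth_append)
qed simp

lemma length_concat_rows: "length (concat (map (\<lambda>X. map (f X) [0..<u]) Xs)) = length Xs * u"
  by (induction Xs) auto

text \<open>For truncated subtraction, \<open>v - (v - 1)\<close> is the minimum of \<open>v\<close> and 1.\<close>

definition normalize :: com where
  "normalize = Blk [Const 1 1, WOp WSub 1 0 1, WOp WSub 0 0 1]"

lemma normalize_ok:
  assumes "1 \<le> b"
  shows "triple b (\<lambda>w r. w 0 = v) normalize 3 (\<lambda>w r. w 0 = (if v = 0 then 0 else 1))"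
  unfolding normalize_def
  by (rule triple_conseq[OF triple_blk[where P = "\<lambda>w r. w 0 = v"
        and R = "\<lambda>w r. w 0 = (if v = 0 then 0 else 1)"]])
    (use assms in \<open>auto intro: order_trans[OF diff_le_self]\<close>)

definition reduction :: "program \<Rightarrow> program" where
  "reduction P = compile 0 prep @ map (relocate (csize prep) (length P)) P @
     compile (csize prep + length P) normalize"

lemma reduction_runs:
  assumes n: "n \<ge> 1" "length (hs_A x) = n" "length (hs_B x) = n"
    and u: "hs_univ x = u" and X: "X = (!) (hs_A x @ hs_B x)"
    and b: "4 * (n * u) + 4 * n + 6 * u + 40 \<le> b"
    and run: "runs P b (init_state (bv_words (hs_to_bv n u X))
         (map (bv_cost (hs_to_bv n u X)) [0..<bv_n (hs_to_bv n u X)])) t s"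
    and T: "62 * (n * u) + 24 * n + 24 * u + 103 + t \<le> T"
  shows "\<exists>s'. runs (reduction P) b (init_state (hs_words x) []) T s' \<and>
     wmem s' 0 = (if wmem s 0 = 0 then 0 else 1)"
proof -
  let ?h = "wmem (init_state (hs_words x) [])"
  let ?Q = "reduction P"
  let ?i = "init_state (bv_words (hs_to_bv n u X)) (map (bv_cost (hs_to_bv n u X)) [0..<bv_n (hs_to_bv n u X)])"
  have len: "length (hs_words x) = 2 + 2 * n * u"
    using n u by (simp add: hs_words_def length_concat_rows algebra_simps del: map_append)
  have h0: "?h 0 = n" "?h 1 = u" using n u by (simp_all add: init_state_def hs_words_def)
  have hbit: "?h (t + 2) = (if t mod u \<in> X (t div u) then 1 else 0)" if "t < 2 * n * u" for t
  proof -
    have "t < length (hs_A x @ hs_B x) * u" using that n by (simp add: algebra_simps)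
    then have "hs_words x ! (t + 2) = (if t mod u \<in> X (t div u) then 1 else 0)"
      using nth_concat_rows[of t "hs_A x @ hs_B x" u "\<lambda>X k. if k \<in> X then 1 else 0"] u X
      by (simp add: hs_words_def del: map_append concat_append)
    then show ?thesis using len that by (simp add: init_state_def)
  qed
  have hzero: "?h a = 0" if "a \<ge> 2 + 2 * n * u" for a
    using len that by (simp add: init_state_def)
  have bound: "?h a \<le> b" for a
  proof -
    consider "a = 0" | "a = 1" | "2 \<le> a" "a < 2 + 2 * n * u" | "2 + 2 * n * u \<le> a" by linarith
    then show ?thesis
    proof cases
      case 3
      then obtain t where t: "a = t + 2" by (metis add.commute le_Suc_ex)
      then have "t < 2 * n * u" using 3 by simp
      from hbit[OF this] have "?h a \<le> 1" unfolding t by simp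
      then show ?thesis using b by linarith
    qed (use h0 hzero b in auto)
  qed
  have Q: "?Q = [] @ compile (length ([]::program)) prep @
      (map (relocate (csize prep) (length P)) P @ compile (csize prep + length P) normalize)"
    by (simp add: reduction_def)
  have pc: "pc (init_state (hs_words x) []) = length ([]::program)" by (simp add: init_state_def)
  have start: "?h = ?h \<and> rmem (init_state (hs_words x) []) = (\<lambda>_. 0)"
    by (simp add: init_state_def fun_eq_iff)
  obtain t1 s1 where 1: "t1 \<le> 62 * (n * u) + 24 * n + 24 * u + 100"
      "goes ?Q b (init_state (hs_words x) []) t1 s1" "pc s1 = length ([]::program) + csize prep"
      "prepared n u X (wmem s1) (rmem s1)"
    by (rule tripleE[OF prep_ok[where h = ?h, OF n(1) h0 hbit hzero b] Q pc start bound])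
  \<comment> \<open>Up to the program counter, the state is exactly the one in which
    \<open>P\<close> is assumed to start.\<close>
  have s1: "s1 = ?i\<lparr>pc := csize prep\<rparr>"
    using prepared_init_state[OF n(1) h0 hbit hzero b 1(4)] 1(3) by (cases s1) (simp add: init_state_def)
  obtain t2 where 2: "t2 \<le> t" "goes ?Q b s1 t2 (s\<lparr>pc := csize prep + length P\<rparr>)"
    using runs_relocate[OF run, of "compile 0 prep" "compile (csize prep + length P) normalize"] s1
    by (auto simp: reduction_def init_state_def)
  have b1: "1 \<le> b" using b by linarith
  obtain t3 s3 where 3: "t3 \<le> 3" "goes ?Q b (s\<lparr>pc := csize prep + length P\<rparr>) t3 s3"
      "pc s3 = csize prep + length P + csize normalize" "wmem s3 0 = (if wmem s 0 = 0 then 0 else 1)"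
    by (rule tripleE[OF normalize_ok[OF b1, of "wmem s 0"], of ?Q
          "compile 0 prep @ map (relocate (csize prep) (length P)) P" "[]"
          "s\<lparr>pc := csize prep + length P\<rparr>"])
      (use goes_bounded[OF 2(2)] in \<open>auto simp: reduction_def\<close>)
  have "goes ?Q b (init_state (hs_words x) []) (t1 + (t2 + t3)) s3"
    using 1(2) 2(2) 3(2) by (blast intro: goes_trans)
  then have "runs ?Q b (init_state (hs_words x) []) T s3"
    by (rule goes_runs) (use 1 2 3 T in \<open>auto simp: halted_def reduction_def\<close>)
  then show ?thesis using 3(4) by blast
qed

lemma has_hitting_set_iff:
  assumes "length A = n" "length B = n" "\<forall>X\<in>set A \<union> set B. X \<subseteq> {..<u}"
  shows "has_hitting_set A B \<longleftrightarrow> (\<exists>i<n. \<forall>j<n. meets n u ((!) (A @ B)) i j)"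
proof -
  have "A ! i \<inter> B ! j \<noteq> {} \<longleftrightarrow> meets n u ((!) (A @ B)) i j" if "i < n" "j < n" for i j
  proof -
    have "k < u" if "k \<in> A ! i" for k using assms \<open>i < n\<close> that by (metis UnI1 lessThan_iff nth_mem subsetD)
    moreover have "(A @ B) ! i = A ! i" "(A @ B) ! (n + j) = B ! j"
      using assms that by (simp_all add: nth_append)
    ultimately show ?thesis by (auto simp: meets_def)
  qed
  moreover have "has_hitting_set A B \<longleftrightarrow> (\<exists>i<length A. \<forall>j<length B. A ! i \<inter> B ! j \<noteq> {})"
    unfolding has_hitting_set_def all_set_conv_all_nth Bex_def in_set_conv_nth by blast
  ultimately show ?thesis using assms(1,2) by metis
qed

text \<open>The \<open>2 * n * u\<close> bit edges are paid for by \<open>c\<close>. The others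
  number at most as many as the vertices, and the logarithm is at least 1, so they fit into the
  additional 1.\<close>

lemma hs_to_bv_instance:
  assumes "n \<ge> 1" "real u \<le> c * log 2 (real n)" "c \<ge> 0"
  shows "hs_to_bv n u X \<in> instances (balanced_vertex_problem (c + 1))"
proof -
  let ?N = "9 + 2 * n + 3 * u"
  have "bv_E (hs_to_bv n u X) = set (map (\<lambda>(x, y). {x, y}) (hs_edges n u X))"
    by (simp add: bv_E_def hs_to_bv_def)
  then have card: "card (bv_E (hs_to_bv n u X)) = 8 + 2 * n * u + 2 * n + 3 * u"
    using distinct_card[OF distinct_hs_E[of n u X]] length_hs_edges[of n u X] by simp
  have l1: "1 \<le> log 2 (real ?N)" by (subst le_log_iff) auto
  have "real u \<le> c * log 2 (real n)" by (rule assms)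
  also have "\<dots> \<le> c * log 2 (real ?N)" using assms by (intro mult_left_mono) auto
  finally have u: "real u \<le> c * log 2 (real ?N)" .
  have "real (8 + 2 * n * u + 2 * n + 3 * u) \<le> real ?N * real u + real ?N * 1"
    by (simp add: algebra_simps)
  also have "\<dots> \<le> real ?N * (c * log 2 (real ?N)) + real ?N * log 2 (real ?N)"
    using u l1 by (intro add_mono mult_left_mono) auto
  also have "\<dots> = (c + 1) * real ?N * log 2 (real ?N)" by (simp add: algebra_simps)
  finally show ?thesis
    using hs_to_bv_valid[of n u X] card by (simp add: balanced_vertex_problem_def hs_to_bv_def)
qed

text \<open>\<open>solvable_in\<close> bounds words by a pure power of \<open>n + 2\<close>, so
  constant factors have to move into the exponent.\<close>

lemma le_base_power: "m \<le> (n + 2) ^ m" for m n :: nat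
proof -
  have "m \<le> 2 ^ m" by (rule less_imp_le) (rule less_exp)
  also have "\<dots> \<le> (n + 2) ^ m" by (rule power_mono) auto
  finally show ?thesis .
qed

text \<open>One bound must serve both the preparation and \<open>P\<close>, whose own bound is in
  terms of the larger vertex number; the exponent is the sum of the two exponents. The crude
  \<open>u \<le> C * n\<close> suffices for a polynomial bound.\<close>

lemma word_bound:
  fixes n u C k :: nat
  assumes "u \<le> C * n"
  defines "b \<equiv> (n + 2) ^ ((14 + 3 * C) * k + 46 + 10 * C)"
  shows "4 * (n * u) + 4 * n + 6 * u + 40 \<le> b" "(9 + 2 * n + 3 * u + 2) ^ k \<le> b"
proof -
  have nu: "n * u \<le> C * (n * n)" using mult_le_mono2[OF assms(1), of n] by (simp add: mult_ac)
  have "4 * (n * u) + 4 * n + 6 * u + 40 \<le> 4 * (C * (n * n)) + 4 * n + 6 * (C * n) + 40"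
    using nu assms(1) by linarith
  also have "\<dots> \<le> (44 + 10 * C) * (n + 2) ^ 2"
    by (simp add: power2_eq_square algebra_simps)
  also have "\<dots> \<le> (n + 2) ^ (44 + 10 * C) * (n + 2) ^ 2"
    by (intro mult_le_mono1 le_base_power)
  also have "\<dots> = (n + 2) ^ (46 + 10 * C)" by (simp add: power_add[symmetric])
  also have "\<dots> \<le> b" unfolding b_def by (rule power_increasing) auto
  finally show "4 * (n * u) + 4 * n + 6 * u + 40 \<le> b" .
  have "9 + 2 * n + 3 * u + 2 \<le> 9 + 2 * n + 3 * (C * n) + 2" using assms(1) by linarith
  also have "\<dots> \<le> (13 + 3 * C) * (n + 2)" by (simp add: algebra_simps)
  also have "\<dots> \<le> (n + 2) ^ (13 + 3 * C) * (n + 2)" by (intro mult_le_mono1 le_base_power)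
  also have "\<dots> = (n + 2) ^ (14 + 3 * C)" 
  proof -
    have "14 + 3 * C = Suc (13 + 3 * C)" by simp
    then show ?thesis by (simp only: power_Suc2)
  qed
  finally have "(9 + 2 * n + 3 * u + 2) ^ k \<le> ((n + 2) ^ (14 + 3 * C)) ^ k"
    by (rule power_mono) simp
  also have "\<dots> = (n + 2) ^ ((14 + 3 * C) * k)" by (simp add: power_mult)
  also have "\<dots> \<le> b" unfolding b_def by (rule power_increasing) auto
  finally show "(9 + 2 * n + 3 * u + 2) ^ k \<le> b" .
qed

section \<open>Running time of the reduction\<close>

definition univ_bound :: "real \<Rightarrow> nat \<Rightarrow> nat" where
  "univ_bound c n = nat \<lfloor>c * log 2 (real n)\<rfloor>"

lemma log2_le: "n \<ge> 1 \<Longrightarrow> log 2 (real n) \<le> real n"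
  by (metis log2_of_power_le less_exp less_imp_le of_nat_0_less_iff of_nat_le_iff zero_less_one_class.zero_less_one le_trans less_le_trans)

lemma univ_bound_le:
  assumes "n \<ge> 1" "c \<ge> 0"
  shows "univ_bound c n \<le> nat \<lceil>c\<rceil> * n"
proof -
  have "c * log 2 (real n) \<le> c * real n" using log2_le assms by (intro mult_left_mono) auto
  also have "\<dots> \<le> real (nat \<lceil>c\<rceil> * n)"
    by (simp add: mult_right_mono of_nat_ceiling)
  finally show ?thesis unfolding univ_bound_def by linarith
qed

text \<open>The time may depend on \<open>n\<close> only, whereas the vertex number also depends on
  \<open>u\<close>, and \<open>T\<close> need not be monotone; hence the maximum over all admissible
  \<open>u\<close>.\<close>

definition red_time :: "real \<Rightarrow> (nat \<Rightarrow> nat) \<Rightarrow> nat \<Rightarrow> nat" where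
  "red_time c T n = 62 * (n * univ_bound c n) + 24 * n + 24 * univ_bound c n + 103 +
     Max ((\<lambda>u. T (9 + 2 * n + 3 * u)) ` {..univ_bound c n})"

text \<open>As log n is O(n^(1/2)), the preparation takes O(n^(3/2)), which
  \<open>\<delta> \<le> 1 / 2\<close> absorbs. The cap also makes \<open>2 - \<delta>\<close>
  positive, so that the bound grows with the vertex number.\<close>

lemma red_time_bigo:
  assumes T: "(\<lambda>n. real (T n)) \<in> O(\<lambda>n. real n powr (2 - \<epsilon>))" and c: "c \<ge> 0" and \<delta>: "\<delta> \<le> \<epsilon>" "\<delta> \<le> 1 / 2"
  shows "(\<lambda>n. real (red_time c T n)) \<in> O(\<lambda>n. real n powr (2 - \<delta>))"
proof -
  obtain K where K: "K > 0" "eventually (\<lambda>n. norm (real (T n)) \<le> K * norm (real n powr (2 - \<epsilon>))) at_top"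
    using landau_o.bigE[OF T] by blast
  then obtain n0 where n0: "\<And>n. n \<ge> n0 \<Longrightarrow> real (T n) \<le> K * real n powr (2 - \<epsilon>)"
    by (auto simp: eventually_at_top_linorder)
  \<comment> \<open>\<open>?D\<close> bounds the ratio of the vertex number to \<open>n\<close>, and
    \<open>?L\<close> the ratio of \<open>univ_bound c n\<close> to n^(1/2). Below, 86 is 62 + 24
    and 127 is 24 + 103.\<close>
  let ?D = "real (11 + 3 * nat \<lceil>c\<rceil>)" and ?L = "c * 2 / ln 2"
  have "norm (real (red_time c T n)) \<le> (86 * ?L + 127 + K * ?D powr (2 - \<delta>)) * norm (real n powr (2 - \<delta>))"
    if n: "n \<ge> max 1 n0" for n
  proof -
    let ?U = "univ_bound c n" and ?p = "real n powr (2 - \<delta>)"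
    have n1: "1 \<le> real n" using n by simp
    have "real ?U \<le> c * log 2 (real n)" using c n1 by (simp add: univ_bound_def)
    also have "\<dots> \<le> c * ((real n powr (1 / 2) / (1 / 2)) / ln 2)"
      unfolding log_def using c n1 by (intro mult_left_mono divide_right_mono ln_powr_bound) auto
    finally have U: "real ?U \<le> ?L * real n powr (1 / 2)" by (simp add: field_simps)
    have L: "?L \<ge> 0" using c by simp
    have "real n * real ?U \<le> real n * (?L * real n powr (1 / 2))" using U by (intro mult_left_mono) auto
    also have "\<dots> = ?L * real n powr (1 + 1 / 2)" using n1 by (simp only: powr_add) simp
    also have "\<dots> \<le> ?L * ?p" using \<delta> n1 L by (intro mult_left_mono powr_mono) auto
    finally have nU: "real n * real ?U \<le> ?L * ?p" .
    have "1 * real ?U \<le> real n * real ?U" using n1 by (intro mult_right_mono) auto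
    then have U': "real ?U \<le> ?L * ?p" using nU by simp
    have np: "real n \<le> ?p" using powr_mono[of 1 "2 - \<delta>" "real n"] n1 \<delta> by simp
    have "T (9 + 2 * n + 3 * u) \<le> K * ?D powr (2 - \<delta>) * ?p" if u: "u \<le> ?U" for u
    proof -
      let ?N = "9 + 2 * n + 3 * u"
      have "u \<le> nat \<lceil>c\<rceil> * n" using u univ_bound_le[of n c] c n by simp
      then have "?N \<le> (11 + 3 * nat \<lceil>c\<rceil>) * n" using n by (simp add: algebra_simps)
      then have N: "real ?N \<le> ?D * real n" by (metis of_nat_le_iff of_nat_mult)
      have "real (T ?N) \<le> K * real ?N powr (2 - \<epsilon>)" by (rule n0) (use n in simp)
      also have "\<dots> \<le> K * real ?N powr (2 - \<delta>)" using K \<delta> by (intro mult_left_mono powr_mono) auto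
      also have "\<dots> \<le> K * (?D * real n) powr (2 - \<delta>)"
        using K \<delta> N by (intro mult_left_mono powr_mono2) auto
      also have "\<dots> = K * ?D powr (2 - \<delta>) * ?p" by (simp add: powr_mult)
      finally show ?thesis .
    qed
    then have "\<And>y. y \<in> (\<lambda>u. T (9 + 2 * n + 3 * u)) ` {..?U} \<Longrightarrow> real y \<le> K * ?D powr (2 - \<delta>) * ?p" by auto
    moreover have "Max ((\<lambda>u. T (9 + 2 * n + 3 * u)) ` {..?U}) \<in> (\<lambda>u. T (9 + 2 * n + 3 * u)) ` {..?U}"
      by (rule Max_in) auto
    ultimately have M: "real (Max ((\<lambda>u. T (9 + 2 * n + 3 * u)) ` {..?U})) \<le> K * ?D powr (2 - \<delta>) * ?p" .
    have "real (red_time c T n) = 62 * (real n * real ?U) + 24 * real n + 24 * real ?U + 103 +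
        real (Max ((\<lambda>u. T (9 + 2 * n + 3 * u)) ` {..?U}))"
      by (simp add: red_time_def)
    also have "\<dots> \<le> 62 * (?L * ?p) + 24 * ?p + 24 * (?L * ?p) + 103 * ?p + K * ?D powr (2 - \<delta>) * ?p"
      using nU U' np M n1 by linarith
    also have "\<dots> \<le> (86 * ?L + 127 + K * ?D powr (2 - \<delta>)) * ?p"
      by (simp add: algebra_simps)
    finally show ?thesis by simp
  qed
  then show ?thesis
    by (intro bigoI[where c = "86 * ?L + 127 + K * ?D powr (2 - \<delta>)"])
      (unfold eventually_at_top_linorder, blast)
qed

text \<open>The program for \<open>c + 1\<close> serves \<open>c\<close>, but the conditions on
  \<open>\<delta>\<close> do not mention \<open>c\<close>: the conjecture asks for one exponent for
  all \<open>c\<close>.\<close>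

lemma hitting_set_solvable:
  assumes BV: "solvable_in (balanced_vertex_problem (c + 1)) (\<lambda>n. real n powr (2 - \<epsilon>))"
    and c: "c \<ge> 1" and \<delta>: "\<delta> \<le> \<epsilon>" "\<delta> \<le> 1 / 2"
  shows "solvable_in (hitting_set_problem c) (\<lambda>n. real n powr (2 - \<delta>))"
proof -
  obtain P k T where T: "(\<lambda>n. real (T n)) \<in> O(\<lambda>n. real n powr (2 - \<epsilon>))"
    and P: "\<And>y. y \<in> instances (balanced_vertex_problem (c + 1)) \<Longrightarrow>
        \<exists>s. runs P ((bv_n y + 2) ^ k) (init_state (bv_words y) (map (bv_cost y) [0..<bv_n y])) (T (bv_n y)) s \<and>
          balanced_vertex (bv_V y) (bv_E y) (bv_cost y) (bv_list y) (wmem s 0)"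
    using BV unfolding solvable_in_def by (auto simp: balanced_vertex_problem_def)
  let ?C = "nat \<lceil>c\<rceil>"
  let ?k = "(14 + 3 * ?C) * k + 46 + 10 * ?C"
  show ?thesis
    unfolding solvable_in_def
  proof (rule exI[of _ "reduction P"], rule exI[of _ ?k], rule exI[of _ "red_time c T"], intro conjI ballI)
    show "(\<lambda>n. real (red_time c T n)) \<in> O(\<lambda>n. real n powr (2 - \<delta>))"
      by (rule red_time_bigo[OF T _ \<delta>]) (use c in simp)
    fix x assume x: "x \<in> instances (hitting_set_problem c)"
    define n u X where "n = length (hs_A x)" and "u = hs_univ x" and "X = (!) (hs_A x @ hs_B x)"
    have n: "n \<ge> 1" "length (hs_B x) = n" and sub: "\<forall>X\<in>set (hs_A x) \<union> set (hs_B x). X \<subseteq> {..<u}"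
      and u: "real u \<le> c * log 2 (real n)"
      using x by (auto simp: hitting_set_problem_def n_def u_def)
    have uU: "u \<le> univ_bound c n" using u unfolding univ_bound_def by linarith
    then have uC: "u \<le> ?C * n" using univ_bound_le[OF n(1), of c] c by linarith
    let ?y = "hs_to_bv n u X"
    obtain s where s: "runs P ((bv_n ?y + 2) ^ k) (init_state (bv_words ?y) (map (bv_cost ?y) [0..<bv_n ?y])) (T (bv_n ?y)) s"
      "balanced_vertex (bv_V ?y) (bv_E ?y) (bv_cost ?y) (bv_list ?y) (wmem s 0)"
      using P[OF hs_to_bv_instance[OF n(1) u, of X]] c by auto
    have "wmem s 0 = 0 \<longleftrightarrow> \<not> (\<exists>i<n. \<forall>j<n. meets n u X i j)"
      by (rule hs_balanced_vertex_0_iff[OF n(1)])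
        (use s(2) in \<open>simp add: bv_V_def bv_E_def hs_E_def hs_to_bv_def\<close>)
    also have "\<dots> \<longleftrightarrow> \<not> has_hitting_set (hs_A x) (hs_B x)"
      using has_hitting_set_iff[OF n_def[symmetric] n(2) sub] by (simp add: X_def)
    finally have answer: "wmem s 0 = 0 \<longleftrightarrow> \<not> has_hitting_set (hs_A x) (hs_B x)" .
    let ?b = "(n + 2) ^ ?k"
    have "(bv_n ?y + 2) ^ k \<le> ?b" using word_bound(2)[OF uC, of k] by (simp add: hs_to_bv_def)
    then have run: "runs P ?b (init_state (bv_words ?y) (map (bv_cost ?y) [0..<bv_n ?y])) (T (bv_n ?y)) s"
      using s(1) unfolding runs_def by (meson order_trans)
    have "T (bv_n ?y) \<le> Max ((\<lambda>u. T (9 + 2 * n + 3 * u)) ` {..univ_bound c n})"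
      using uU by (intro Max_ge) (auto simp: hs_to_bv_def)
    moreover have "n * u \<le> n * univ_bound c n" using uU by simp
    ultimately have time: "62 * (n * u) + 24 * n + 24 * u + 103 + T (bv_n ?y) \<le> red_time c T n"
      unfolding red_time_def using uU by linarith
    have "\<exists>s'. runs (reduction P) ?b (init_state (hs_words x) []) (red_time c T n) s' \<and>
      wmem s' 0 = (if wmem s 0 = 0 then 0 else 1)"
      by (rule reduction_runs[OF n(1) n_def[symmetric] n(2) u_def[symmetric] X_def
            word_bound(1)[OF uC] run time])
    then show "\<exists>s. runs (reduction P) ((param (hitting_set_problem c) x + 2) ^ ?k)
        (init_state (input_words (hitting_set_problem c) x) (input_reals (hitting_set_problem c) x))
        (red_time c T (param (hitting_set_problem c) x)) s \<and> correct (hitting_set_problem c) x (wmem s 0)"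
      using answer by (auto simp: hitting_set_problem_def n_def)
  qed
qed

theorem theorem2p8:
  assumes Hitting_Set_Conjecture
  shows "\<not> (\<exists>\<epsilon>::real. \<epsilon> > 0 \<and>
           (\<forall>c\<ge>1. solvable_in (balanced_vertex_problem c) (\<lambda>n. real n powr (2 - \<epsilon>))))"
proof
  assume "\<exists>\<epsilon>::real. \<epsilon> > 0 \<and>
    (\<forall>c\<ge>1. solvable_in (balanced_vertex_problem c) (\<lambda>n. real n powr (2 - \<epsilon>)))"
  then obtain \<epsilon> :: real where \<epsilon>: "\<epsilon> > 0"
    "\<And>c. c \<ge> 1 \<Longrightarrow> solvable_in (balanced_vertex_problem c) (\<lambda>n. real n powr (2 - \<epsilon>))" by blast
  have "solvable_in (hitting_set_problem c) (\<lambda>n. real n powr (2 - min \<epsilon> (1 / 2)))" if "c \<ge> 1" for c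
    by (rule hitting_set_solvable[OF \<epsilon>(2)]) (use that in auto)
  then show False
    using assms \<epsilon>(1) unfolding Hitting_Set_Conjecture_def
    by (auto dest: spec[of _ "min \<epsilon> (1 / 2)"])
qed

end
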